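(* Let $p$ be a prime, $G$ a finite $p$-group of nilpotency class $2$, and $w\in F_k$. (i) If $w\notin[F_k,F_k]$, then either $P_{w,G}$ is a constant function on $G$, or there exist integers $r>0$, $1\le\ell\le n\le k$ and nonnegative integers $s_1,\dots,s_{n-1}$ with $s_1<s_2<\cdots<s_{\ell-1}<r$ and $s_j<r$ for all $j\ge\ell$, such that $w$ and $v_p(p^r,\ell;s_1,\dots,s_{n-1})$ are $F_k(G)$-automorphic. (ii) If $w\in[F_k,F_k]$, then there exist $n\le k$ and nonnegative integers $s_1,\dots,s_{n-1}$ such that $w$ and $v_p(0,1;s_1,\dots,s_{n-1})$ are $F_k(G)$-automorphic.
   Context: $F_k$ is the free group on $x_1,\dots,x_k$; $[F_k,F_k]$ its commutator subgroup; $[a,b]:=aba^{-1}b^{-1}$. For $w\in F_k$, $P_{w,G}(g):=|\{(g_1,\dots,g_k)\in G^k: w(g_1,\dots,g_k)=g\}|/|G|^k$. The set $F_k(G)$ of word maps $G^k\to G$ induced by elements of $F_k$ is a group under pointwise multiplication; $w_1,w_2\in F_k$ are $F_k(G)$-automorphic if some group automorphism of $F_k(G)$ sends the word map of $w_1$ to that of $w_2$. For $t_0\ge0$, $1\le\ell\le n\le k$ and nonnegative integers $s_i$, $$v_p(t_0,\ell;s_1,\dots,s_{n-1}):=x_1^{t_0}\Big(\prod_{i=1}^{\ell-1}[x_i,x_{i+1}]^{p^{s_i}}\Big)\Big([x_\ell,x_{\ell+1}]^{p^{s_\ell}}[x_{\ell+2},x_{\ell+3}]^{p^{s_{\ell+2}}}\cdots[x_{n-1},x_n]^{p^{s_{n-1}}}\Big),$$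 where the last factor is the product of $[x_j,x_{j+1}]^{p^{s_j}}$ over $j=\ell,\ell+2,\ell+4,\dots$ with $j\le n-1$ (empty if $\ell\ge n$). *)

theory Defs
  imports "HOL-Algebra.Algebra" "HOL-Library.FuncSet"
begin

fun lower_central :: "('a, 'b) monoid_scheme \<Rightarrow> nat \<Rightarrow> 'a set" where
  "lower_central G 0 = carrier G"
| "lower_central G (Suc 0) = carrier G"
| "lower_central G (Suc (Suc i)) =
     generate G {x \<otimes>\<^bsub>G\<^esub> y \<otimes>\<^bsub>G\<^esub> inv\<^bsub>G\<^esub> x \<otimes>\<^bsub>G\<^esub> inv\<^bsub>G\<^esub> y
                 | x y. x \<in> lower_central G (Suc i) \<and> y \<in> carrier G}"

definition nilpotency_class_two :: "('a, 'b) monoid_scheme \<Rightarrow> bool" where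
  "nilpotency_class_two G \<longleftrightarrow>
     lower_central G 2 \<noteq> {\<one>\<^bsub>G\<^esub>} \<and> lower_central G 3 = {\<one>\<^bsub>G\<^esub>}"

definition finite_p_group :: "nat \<Rightarrow> ('a, 'b) monoid_scheme \<Rightarrow> bool" where
  "finite_p_group p G \<longleftrightarrow> group G \<and> finite (carrier G) \<and> (\<exists>m. card (carrier G) = p ^ m)"

text \<open>A letter (i, False) stands for x_i, (i, True) for x_i^-1.  Elements of F_k are
  represented by (not necessarily reduced) words over x_1..x_k; two words represent the same
  element of F_k iff they are freely equivalent.\<close>

type_synonym letter = "nat \<times> bool"

definition words :: "nat \<Rightarrow> letter list set" where
  "words k = lists ({1..k} \<times> UNIV)"

inductive free_step :: "letter list \<Rightarrow> letter list \<Rightarrow> bool" where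
  "free_step (xs @ [(i, b), (i, \<not> b)] @ ys) (xs @ ys)"

definition free_equiv :: "letter list \<Rightarrow> letter list \<Rightarrow> bool" where
  "free_equiv = (sup free_step free_step\<inverse>\<inverse>)\<^sup>*\<^sup>*"

definition inv_word :: "letter list \<Rightarrow> letter list" where
  "inv_word w = rev (map (\<lambda>(i, b). (i, \<not> b)) w)"

definition gen :: "nat \<Rightarrow> letter list" where
  "gen i = [(i, False)]"

definition word_pow :: "letter list \<Rightarrow> nat \<Rightarrow> letter list" where
  "word_pow w m = concat (replicate m w)"

definition comm_word :: "letter list \<Rightarrow> letter list \<Rightarrow> letter list" where
  "comm_word u v = u @ v @ inv_word u @ inv_word v"

text \<open>Membership in the commutator subgroup [F_k,F_k]: w is freely equal to a product of
  commutators of elements of F_k (the subgroup generated by commutators consists of such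
  products, as [a,b]^-1 = [b,a]).\<close>
definition in_commutator_subgroup :: "nat \<Rightarrow> letter list \<Rightarrow> bool" where
  "in_commutator_subgroup k w \<longleftrightarrow>
     (\<exists>cs. set cs \<subseteq> words k \<times> words k \<and>
           free_equiv w (concat (map (\<lambda>(u, v). comm_word u v) cs)))"

definition v_word :: "nat \<Rightarrow> nat \<Rightarrow> nat \<Rightarrow> nat \<Rightarrow> (nat \<Rightarrow> nat) \<Rightarrow> letter list" where
  "v_word p t0 l n s =
     word_pow (gen 1) t0
     @ concat (map (\<lambda>i. word_pow (comm_word (gen i) (gen (Suc i))) (p ^ s i)) [1..<l])
     @ concat (map (\<lambda>j. word_pow (comm_word (gen j) (gen (Suc j))) (p ^ s j))
                   (filter (\<lambda>j. even (j - l)) [l..<n]))"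

definition assignments :: "('a, 'b) monoid_scheme \<Rightarrow> nat \<Rightarrow> (nat \<Rightarrow> 'a) set" where
  "assignments G k = {1..k} \<rightarrow>\<^sub>E carrier G"

definition eval_word :: "('a, 'b) monoid_scheme \<Rightarrow> (nat \<Rightarrow> 'a) \<Rightarrow> letter list \<Rightarrow> 'a" where
  "eval_word G g w =
     foldr (\<lambda>(i, b) acc. (if b then inv\<^bsub>G\<^esub> (g i) else g i) \<otimes>\<^bsub>G\<^esub> acc) w \<one>\<^bsub>G\<^esub>"

definition word_map :: "('a, 'b) monoid_scheme \<Rightarrow> nat \<Rightarrow> letter list \<Rightarrow> (nat \<Rightarrow> 'a) \<Rightarrow> 'a" where
  "word_map G k w = (\<lambda>g \<in> assignments G k. eval_word G g w)"

definition word_map_group :: "('a, 'b) monoid_scheme \<Rightarrow> nat \<Rightarrow> ((nat \<Rightarrow> 'a) \<Rightarrow> 'a) monoid" where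
  "word_map_group G k =
     \<lparr> carrier = word_map G k ` words k,
       monoid.mult = (\<lambda>f1 f2. \<lambda>g \<in> assignments G k. f1 g \<otimes>\<^bsub>G\<^esub> f2 g),
       monoid.one = (\<lambda>g \<in> assignments G k. \<one>\<^bsub>G\<^esub>) \<rparr>"

definition automorphic :: "('a, 'b) monoid_scheme \<Rightarrow> nat \<Rightarrow> letter list \<Rightarrow> letter list \<Rightarrow> bool" where
  "automorphic G k w1 w2 \<longleftrightarrow>
     (\<exists>\<phi> \<in> iso (word_map_group G k) (word_map_group G k).
        \<phi> (word_map G k w1) = word_map G k w2)"

definition P_prob :: "nat \<Rightarrow> letter list \<Rightarrow> ('a, 'b) monoid_scheme \<Rightarrow> 'a \<Rightarrow> real" where
  "P_prob k w G h =
     real (card {g \<in> assignments G k. eval_word G g w = h}) / real (card (carrier G)) ^ k"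

end

theory Submission
  imports Defs
begin

text \<open>
  In a group of class two every word map has the form \<open>\<Prod> x\<^sub>i\<^bsup>a\<^sub>i\<^esup> \<cdot> \<Prod> [x\<^sub>i, x\<^sub>j]\<^bsup>u\<^sub>i\<^sub>j\<^esup>\<close>,
  and the second factor depends only on the alternating matrix \<open>B = U - U\<^sup>T\<close> modulo \<open>p\<^sup>N = |G|\<close>.
  Substituting words \<open>u\<^sub>m\<close> with exponent sums \<open>A\<close> replaces \<open>B\<close> by \<open>A\<^sup>T B A\<close>, and a substitution that
  permutes \<open>G\<^sup>k\<close> induces an automorphism of the finite group of word maps. Units modulo \<open>p\<close> are
  invertible exponents, so \<open>w\<close> can be brought to \<open>x\<^sub>1\<^bsup>p\<^sup>r\<^esup>\<close> times a product of commutators. If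
  \<open>r = 0\<close>, replacing \<open>x\<^sub>1\<close> by \<open>x\<^sub>1\<close> times a central word permutes \<open>G\<^sup>k\<close>, hence the distribution is
  uniform. If \<open>r > 0\<close>, such a replacement changes \<open>B\<close> by an arbitrary alternating multiple of \<open>p\<^sup>r\<close>,
  and it remains to classify alternating matrices modulo \<open>p\<^sup>r\<close> under base changes that fix \<open>x\<^sub>1\<close>.
\<close>

section \<open>Alternating integer matrices modulo a prime power\<close>

text \<open>Since \<open>x_1\<close> carries the power \<open>x_1^(p^r)\<close>, it may occur in the
  words substituted for the other generators but may not be replaced itself. A pivot
  \<open>B i j\<close> that avoids this frozen index can be cleared from both sides and yields an
  isolated pair. So the neighbour is frozen next, and a chain grows instead of a sum of hyperbolic
  planes. The index \<open>h\<close> of the reduction is the currently frozen one; starting with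
  \<open>h = 0\<close>, a row that is always zero, gives the ordinary classification and settles the
  commutator case.

  Only elementary substitutions occur. For each of them injectivity on \<open>G^k\<close> can be
  read off directly, and finiteness turns injectivity into a permutation, so the moves are never
  assembled into one matrix and determinants never appear.\<close>

definition alternating_on :: "nat \<Rightarrow> (nat \<Rightarrow> nat \<Rightarrow> int) \<Rightarrow> bool" where
  "alternating_on K B \<longleftrightarrow>
     (\<forall>i j. B j i = - B i j) \<and> (\<forall>i j. i \<notin> {1..K} \<longrightarrow> B i j = 0)"

text \<open>The congruence \<open>A^T B A\<close> for the identity matrix \<open>A\<close> with row
  \<open>i\<close> replaced by \<open>a\<close>, which is the effect of substituting for
  \<open>x_i\<close> a word with exponent sums \<open>a\<close>. The term
  \<open>a m * a n * B i i\<close> is absent because an alternating matrix has zero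
  diagonal.\<close>

definition row_change :: "nat \<Rightarrow> (nat \<Rightarrow> int) \<Rightarrow> (nat \<Rightarrow> nat \<Rightarrow> int) \<Rightarrow> nat \<Rightarrow> nat \<Rightarrow> int" where
  "row_change i a B m n =
     (if m = i \<or> n = i then 0 else B m n)
     + (if m = i then 0 else a n * B m i) + (if n = i then 0 else a m * B i n)"

inductive form_step :: "nat \<Rightarrow> nat \<Rightarrow> nat \<Rightarrow> nat \<Rightarrow> nat \<Rightarrow>
    (nat \<Rightarrow> nat \<Rightarrow> int) \<Rightarrow> (nat \<Rightarrow> nat \<Rightarrow> int) \<Rightarrow> bool" for p r K h k where
  row: "i \<in> {h<..k} \<Longrightarrow> coprime (a i) (int p) \<Longrightarrow> (\<And>j. j \<notin> {h..k} \<Longrightarrow> a j = 0) \<Longrightarrow> a 0 = 0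
    \<Longrightarrow> form_step p r K h k B (row_change i a B)"
| perm: "\<pi> permutes {h<..k} \<Longrightarrow> form_step p r K h k B (\<lambda>m n. B (\<pi> m) (\<pi> n))"
| modulo: "(\<And>m n. int p ^ r dvd B m n - B' m n) \<Longrightarrow> alternating_on K B'
    \<Longrightarrow> form_step p r K h k B B'"

text \<open>The alternating matrix belonging to the product of
  \<open>[x_e, x_(e+1)]^(p^(s e))\<close> over \<open>e\<close> in \<open>E\<close>.\<close>

definition edge_form :: "nat \<Rightarrow> nat set \<Rightarrow> (nat \<Rightarrow> nat) \<Rightarrow> nat \<Rightarrow> nat \<Rightarrow> int" where
  "edge_form p E s i j =
     (if j = Suc i \<and> i \<in> E then int p ^ s i
      else if i = Suc j \<and> j \<in> E then - (int p ^ s j) else 0)"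

lemma alternating_onD:
  assumes "alternating_on K B"
  shows "B j i = - B i j" "B i i = 0" "i \<notin> {1..K} \<Longrightarrow> B i j = 0" "j \<notin> {1..K} \<Longrightarrow> B i j = 0"
proof -
  have skew: "\<And>i j. B j i = - B i j" and supp: "\<And>i j. i \<notin> {1..K} \<Longrightarrow> B i j = 0"
    using assms unfolding alternating_on_def by blast+
  show "B j i = - B i j" by (rule skew)
  show "B i i = 0" using skew[of i i] by simp
  show "i \<notin> {1..K} \<Longrightarrow> B i j = 0" by (rule supp)
  show "j \<notin> {1..K} \<Longrightarrow> B i j = 0" using skew[of i j] supp[of j i] by simp
qed

section \<open>Stability of alternating matrices under the elementary moves\<close>

lemma alternating_on_add:
  assumes "alternating_on K B" and "alternating_on K C"
  shows "alternating_on K (\<lambda>m n. B m n + C m n)"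
  unfolding alternating_on_def
proof (intro conjI allI impI)
  fix i j
  show "B j i + C j i = - (B i j + C i j)"
    using alternating_onD(1)[OF assms(1), of j i] alternating_onD(1)[OF assms(2), of j i] by simp
  assume "i \<notin> {1..K}"
  then show "B i j + C i j = 0"
    using alternating_onD(3)[OF assms(1)] alternating_onD(3)[OF assms(2)] by simp
qed

lemma alternating_on_restrict:
  assumes "alternating_on K B"
  shows "alternating_on K (\<lambda>m n. if m \<in> S \<and> n \<in> S then B m n else 0)"
  unfolding alternating_on_def
proof (intro conjI allI impI)
  fix i j
  show "(if j \<in> S \<and> i \<in> S then B j i else 0) = - (if i \<in> S \<and> j \<in> S then B i j else 0)"
    using alternating_onD(1)[OF assms, of j i] by simp
  assume "i \<notin> {1..K}"
  then show "(if i \<in> S \<and> j \<in> S then B i j else 0) = 0"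
    using alternating_onD(3)[OF assms] by simp
qed

lemma alternating_on_edge_form:
  assumes "E \<subseteq> {1..<K}"
  shows "alternating_on K (edge_form p E s)"
  using assms unfolding alternating_on_def edge_form_def by auto

lemma alternating_on_form_step:
  assumes "form_step p r K h k B B'" and "k \<le> K" and "alternating_on K B"
  shows "alternating_on K B'"
  using assms(1)
proof cases
  case (row i a)
  note B = alternating_onD[OF assms(3)]
  have a: "a j = 0" if "j \<notin> {1..K}" for j
    using row(4)[of j] row(5) that assms(2) by (cases "j = 0") auto
  have i: "i \<in> {1..K}"
    using row(2) assms(2) by auto
  show ?thesis
    unfolding row(1) alternating_on_def
  proof (intro conjI allI impI)
    fix m n
    show "row_change i a B n m = - row_change i a B m n"
      unfolding row_change_def using B(1)[of n m] B(1)[of i m] B(1)[of n i] by (simp add: B(2))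
    assume "m \<notin> {1..K}"
    then show "row_change i a B m n = 0"
      unfolding row_change_def using a[of m] B(3)[of m] i by auto
  qed
next
  case (perm \<pi>)
  have "\<pi> m \<notin> {1..K}" if "m \<notin> {1..K}" for m
  proof (cases "m \<in> {h<..k}")
    case True
    with that assms(2) show ?thesis by auto
  next
    case False
    then show ?thesis using that perm(2) by (simp add: permutes_not_in)
  qed
  then show ?thesis
    using assms(3) unfolding perm(1) alternating_on_def by blast
qed

lemma alternating_on_form_steps:
  assumes "(form_step p r K h k)\<^sup>*\<^sup>* B B'" and "k \<le> K" and "alternating_on K B"
  shows "alternating_on K B'"
  using assms(1)
proof (induction rule: rtranclp_induct)
  case base
  show ?case by (rule assms(3))
next
  case (step C D)
  show ?case by (rule alternating_on_form_step[OF step.hyps(2) assms(2) step.IH])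
qed

lemma form_step_mono:
  assumes "form_step p r K h k B B'" and "h' \<le> h" and "k \<le> k'"
  shows "form_step p r K h' k' B B'"
  using assms(1)
proof cases
  case (row i a)
  show ?thesis unfolding row(1)
    by (rule form_step.row) (use row assms(2,3) in auto)
next
  case (perm \<pi>)
  have "\<pi> permutes {h'<..k'}"
    by (rule permutes_subset[OF perm(2)]) (use assms(2,3) in auto)
  then show ?thesis unfolding perm(1) by (rule form_step.perm)
next
  case modulo
  then show ?thesis by (blast intro: form_step.modulo)
qed

lemma form_steps_mono:
  assumes "(form_step p r K h k)\<^sup>*\<^sup>* B B'" and "h' \<le> h" and "k \<le> k'"
  shows "(form_step p r K h' k')\<^sup>*\<^sup>* B B'"
  using assms(1)
proof (induction rule: rtranclp_induct)
  case (step C D)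
  then show ?case
    using form_step_mono[OF step.hyps(2) assms(2,3)] by (meson rtranclp.rtrancl_into_rtrancl)
qed simp

text \<open>A replacement at \<open>i\<close> uses only row and column \<open>i\<close> of the
  summand \<open>C\<close>, and a permutation moves only indices at which \<open>C\<close> vanishes.
  A summand already split off is therefore carried along unchanged, even if it touches the head
  \<open>h\<close>.\<close>

lemma form_step_add:
  assumes "form_step p r K h k B B'" and "alternating_on K C"
    and C: "\<And>m n. m \<in> {h<..k} \<Longrightarrow> C m n = 0"
  shows "form_step p r K h k (\<lambda>m n. B m n + C m n) (\<lambda>m n. B' m n + C m n)"
  using assms(1)
proof cases
  case (row i a)
  note D = alternating_onD[OF assms(2)]
  have "C i n = 0" "C n i = 0" for n
    using C[of i n] D(1)[of n i] row(2) by auto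
  then have "(\<lambda>m n. B' m n + C m n) = row_change i a (\<lambda>m n. B m n + C m n)"
    unfolding row(1) row_change_def by (auto simp: fun_eq_iff)
  then show ?thesis
    using form_step.row[OF row(2,3,4,5)] by simp
next
  case (perm \<pi>)
  have C2: "\<And>m n. n \<in> {h<..k} \<Longrightarrow> C m n = 0"
    by (metis C alternating_onD(1)[OF assms(2)] minus_zero)
  have "C (\<pi> m) (\<pi> n) = C m n" for m n
  proof (cases "m \<in> {h<..k} \<or> n \<in> {h<..k}")
    case True
    then show ?thesis using C C2 permutes_in_image[OF perm(2)] by metis
  next
    case False
    then show ?thesis using permutes_not_in[OF perm(2)] by simp
  qed
  then have "(\<lambda>m n. B' m n + C m n) = (\<lambda>m n. (\<lambda>m n. B m n + C m n) (\<pi> m) (\<pi> n))"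
    unfolding perm(1) by simp
  then show ?thesis
    using form_step.perm[OF perm(2), of p r K "\<lambda>m n. B m n + C m n"] by simp
next
  case modulo
  show ?thesis
    by (rule form_step.modulo) (use modulo assms(2) alternating_on_add in auto)
qed

lemma form_steps_add:
  assumes "(form_step p r K h k)\<^sup>*\<^sup>* B B'" and "alternating_on K C"
    and "\<And>m n. m \<in> {h<..k} \<Longrightarrow> C m n = 0"
  shows "(form_step p r K h k)\<^sup>*\<^sup>* (\<lambda>m n. B m n + C m n) (\<lambda>m n. B' m n + C m n)"
  using assms(1)
proof (induction rule: rtranclp_induct)
  case (step D D')
  then show ?case
    using form_step_add[OF step.hyps(2) assms(2,3)] by (meson rtranclp.rtrancl_into_rtrancl)
qed simp

section \<open>Choice of permutations and of inverses modulo a prime power\<close>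

lemma ex_permutes_two:
  assumes "a \<in> S" "b \<in> S" "i \<in> S" "j \<in> S" "a \<noteq> b" "i \<noteq> j"
  obtains \<pi> where "\<pi> permutes S" "\<pi> a = i" "\<pi> b = j"
proof -
  let ?t = "transpose a i"
  have j': "?t j \<in> S" using assms by (auto simp: transpose_def)
  have "?t j \<noteq> a" using assms by (auto simp: transpose_def)
  then have "(?t \<circ> transpose b (?t j)) a = i" "(?t \<circ> transpose b (?t j)) b = j"
    using assms by (auto simp: transpose_def)
  moreover have "(?t \<circ> transpose b (?t j)) permutes S"
    using assms j' by (intro permutes_compose permutes_swap_id) auto
  ultimately show ?thesis using that by blast
qed

lemma ex_inverse_mod_prime_power:
  fixes u :: int
  assumes "Factorial_Ring.prime p" and "\<not> int p dvd u"
  obtains v where "int p ^ r dvd u * v - 1" "coprime v (int p)"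
proof -
  have "coprime u (int p)"
    using assms by (metis coprime_commute prime_imp_coprime prime_nat_int_transfer)
  \<comment> \<open>The exponent \<open>Suc r\<close> instead of \<open>r\<close> lets the Bezout
    identity force \<open>x\<close> to be coprime to \<open>p\<close> even for
    \<open>r = 0\<close>.\<close>
  then have "gcd u (int p ^ Suc r) = 1"
    by (simp add: coprime_iff_gcd_eq_1 [symmetric])
  then obtain x y where xy: "x * u + y * int p ^ Suc r = 1"
    using bezout_int by metis
  have "u * x - 1 = int p ^ r * (- y * int p)"
    using xy by (simp add: algebra_simps)
  moreover have "coprime x (int p)"
  proof (rule coprimeI)
    fix c assume c: "c dvd x" "c dvd int p"
    then have "c dvd x * u + y * int p ^ Suc r" by simp
    then show "is_unit c" using xy by simp
  qed
  ultimately show ?thesis using that[of x] by simp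
qed

lemma dvd_row_change:
  assumes "\<And>m n. x dvd B m n"
  shows "x dvd row_change i a B m n"
  unfolding row_change_def using assms by auto

lemma edge_form_add:
  assumes "e \<notin> E"
  shows "edge_form p E s m n + edge_form p {e} (\<lambda>_. t) m n = edge_form p (insert e E) (s(e := t)) m n"
proof -
  consider "n = Suc m" | "m = Suc n" | "n \<noteq> Suc m" "m \<noteq> Suc n" by blast
  then show ?thesis
    by cases (use assms in \<open>auto simp: edge_form_def\<close>)
qed

lemma edge_form_empty: "edge_form p {} s = (\<lambda>m n. 0)"
  unfolding edge_form_def by (auto simp: fun_eq_iff)

section \<open>Splitting off an entry of least valuation\<close>

text \<open>Both pivot indices may be replaced, so the pivot splits off like a hyperbolic plane: it
  is moved to position \<open>(k - 1, k)\<close>, a replacement of \<open>x_(k-1)\<close> clears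
  column \<open>k\<close>, and one of \<open>x_k\<close> clears row \<open>k - 1\<close>.
  Divisibility of all entries by \<open>p^s\<close> makes the required quotients integral.\<close>

lemma split_off_pair:
  assumes p: "Factorial_Ring.prime p" and "k \<le> K" and alt: "alternating_on K B"
    and supp: "\<And>m n. m \<notin> {h..k} \<Longrightarrow> B m n = 0"
    and dvd: "\<And>m n. int p ^ s dvd B m n"
    and ij: "i \<in> {h<..k}" "j \<in> {h<..k}" "\<not> int p ^ Suc s dvd B i j"
  obtains C where "alternating_on K C" "\<forall>m n. m \<notin> {h..k - 2} \<longrightarrow> C m n = 0"
    "\<forall>m n. int p ^ s dvd C m n" "h + 2 \<le> k"
    "(form_step p r K h k)\<^sup>*\<^sup>* B (\<lambda>m n. C m n + edge_form p {k - 1} (\<lambda>_. s) m n)"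
proof -
  have "i \<noteq> j"
  proof
    assume "i = j"
    then have "B i j = 0" using alternating_onD(2)[OF alt] by simp
    then show False using ij(3) by simp
  qed
  then have hk: "h + 2 \<le> k" using ij by auto
  then have kk: "k \<noteq> k - Suc 0" by auto
  have "k - 1 \<in> {h<..k}" "k \<in> {h<..k}" "k - 1 \<noteq> k" using hk by auto
  then obtain \<pi> where \<pi>: "\<pi> permutes {h<..k}" "\<pi> (k - 1) = i" "\<pi> k = j"
    using ex_permutes_two ij(1,2) \<open>i \<noteq> j\<close> by metis
  define B1 where "B1 = (\<lambda>m n. B (\<pi> m) (\<pi> n))"
  have step1: "form_step p r K h k B B1"
    unfolding B1_def by (rule form_step.perm[OF \<pi>(1)])
  have alt1: "alternating_on K B1"
    using alternating_on_form_step[OF step1 \<open>k \<le> K\<close> alt] .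
  have supp1: "B1 m n = 0" if "m \<notin> {h..k}" for m n
  proof -
    have "\<pi> m = m" using that \<pi>(1) by (auto intro: permutes_not_in)
    then show ?thesis unfolding B1_def using supp that by simp
  qed
  have dvd1: "int p ^ s dvd B1 m n" for m n unfolding B1_def using dvd .
  define D where "D m n = B1 m n div int p ^ s" for m n
  have BD: "B1 m n = int p ^ s * D m n" for m n unfolding D_def using dvd1 by simp
  define u where "u = D (k - 1) k"
  have u: "\<not> int p dvd u"
  proof
    assume "int p dvd u"
    then have "int p ^ Suc s dvd B1 (k - 1) k"
      unfolding BD u_def by (metis dvd_refl mult_dvd_mono power_Suc2)
    then show False using ij(3) \<pi> unfolding B1_def by simp
  qed
  obtain v where v: "int p ^ r dvd u * v - 1" "coprime v (int p)"
    using ex_inverse_mod_prime_power[OF p u] .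
  define a where "a n = (if n = k - 1 then v else if n = k then 0 else - v * D n k)" for n
  define B2 where "B2 = row_change (k - 1) a B1"
  have D0: "D n k = 0" if "n \<notin> {h..k} \<or> n = 0" for n
    unfolding D_def using supp1[of n k] alternating_onD(3)[OF alt1, of n k] that by auto
  have step2: "form_step p r K h k B1 B2"
    unfolding B2_def
  proof (rule form_step.row)
    show "k - 1 \<in> {h<..k}" using hk by auto
    show "coprime (a (k - 1)) (int p)" unfolding a_def using v(2) by simp
    show "a j = 0" if "j \<notin> {h..k}" for j unfolding a_def using D0[of j] that hk by auto
    show "a 0 = 0" unfolding a_def using D0[of 0] hk by auto
  qed
  have alt2: "alternating_on K B2"
    using alternating_on_form_step[OF step2 \<open>k \<le> K\<close> alt1] .
  have dvd2: "int p ^ s dvd B2 m n" for m n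
    unfolding B2_def by (rule dvd_row_change) (rule dvd1)
  have supp2: "B2 m n = 0" if "m \<notin> {h..k}" for m n
  proof -
    have "m \<noteq> k - 1" "a m = 0" using that hk D0[of m] unfolding a_def by auto
    then show ?thesis unfolding B2_def row_change_def using supp1[OF that] by simp
  qed
  have corner2: "B2 (k - 1) k = int p ^ s * (u * v)"
    unfolding B2_def row_change_def a_def using hk by (simp add: BD u_def)
  have col2: "int p ^ r dvd B2 n k" if "n \<noteq> k - 1" for n
  proof (cases "n = k")
    case True
    then show ?thesis using alternating_onD(2)[OF alt2] by simp
  next
    case False
    then have "B2 n k = - (int p ^ s * D n k) * (u * v - 1)"
      using that kk unfolding B2_def row_change_def a_def by (simp add: BD u_def algebra_simps)
    then show ?thesis using v(1) by simp
  qed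
  define D2 where "D2 m n = B2 m n div int p ^ s" for m n
  have BD2: "B2 m n = int p ^ s * D2 m n" for m n unfolding D2_def using dvd2 by simp
  \<comment> \<open>The corner is already \<open>p^s\<close> modulo \<open>p^r\<close>, so
    subtracting the quotient \<open>D2 (k - 1) n\<close> suffices; \<open>b k = 1\<close> leaves
    column \<open>k\<close> as it was.\<close>
  define b where "b n = (if n = k then 1 else if n = k - 1 then 0 else - D2 (k - 1) n)" for n
  have D20: "D2 (k - 1) n = 0" if "n \<notin> {h..k} \<or> n = 0" for n
    unfolding D2_def using supp2[of n "k - 1"] alternating_onD(4)[OF alt2, of n "k - 1"]
      alternating_onD(1)[OF alt2, of "k - 1" n] that by auto
  define B3 where "B3 = row_change k b B2"
  have step3: "form_step p r K h k B2 B3"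
    unfolding B3_def
  proof (rule form_step.row)
    show "k \<in> {h<..k}" using hk by auto
    show "coprime (b k) (int p)" unfolding b_def by simp
    show "b j = 0" if "j \<notin> {h..k}" for j unfolding b_def using D20[of j] that hk by auto
    show "b 0 = 0" unfolding b_def using D20[of 0] hk by auto
  qed
  have alt3: "alternating_on K B3"
    using alternating_on_form_step[OF step3 \<open>k \<le> K\<close> alt2] .
  have dvd3: "int p ^ s dvd B3 m n" for m n
    unfolding B3_def by (rule dvd_row_change) (rule dvd2)
  have supp3: "B3 m n = 0" if "m \<notin> {h..k}" for m n
  proof -
    have "m \<noteq> k" "b m = 0" using that hk D20[of m] unfolding b_def by auto
    then show ?thesis unfolding B3_def row_change_def using supp2[OF that] by simp
  qed
  have corner3: "B3 (k - 1) k = int p ^ s * (u * v)"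
    unfolding B3_def row_change_def b_def using hk corner2 by simp
  have col3: "int p ^ r dvd B3 n k" if "n \<noteq> k - 1" for n
    unfolding B3_def row_change_def b_def using that col2[OF that] by simp
  have row3: "int p ^ r dvd B3 (k - 1) n" if "n \<noteq> k" for n
  proof (cases "n = k - 1")
    case True
    then show ?thesis using alternating_onD(2)[OF alt3] by simp
  next
    case False
    have "B3 (k - 1) n = B2 (k - 1) n + b n * B2 (k - 1) k"
      using that kk unfolding B3_def row_change_def by (simp add: b_def)
    also have "\<dots> = - (int p ^ s * D2 (k - 1) n) * (u * v - 1)"
      unfolding corner2 using False that by (simp add: b_def BD2[of "k - Suc 0" n] algebra_simps)
    finally have "B3 (k - 1) n = - (int p ^ s * D2 (k - 1) n) * (u * v - 1)" .
    then show ?thesis using v(1) by simp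
  qed
  \<comment> \<open>The cleared entries vanish only modulo \<open>p^r\<close>; truncation makes them
    zero and is justified by a final \<open>modulo\<close> step.\<close>
  define C where "C m n = (if m \<in> {..k - 2} \<and> n \<in> {..k - 2} then B3 m n else 0)" for m n
  have altC: "alternating_on K C"
    unfolding C_def by (rule alternating_on_restrict[OF alt3])
  define T where "T m n = C m n + edge_form p {k - 1} (\<lambda>_. s) m n" for m n
  have altT: "alternating_on K T"
    unfolding T_def
    by (intro alternating_on_add altC alternating_on_edge_form) (use hk \<open>k \<le> K\<close> in auto)
  have corner: "int p ^ r dvd B3 (k - 1) k - T (k - 1) k"
  proof -
    have "T (k - 1) k = int p ^ s" unfolding T_def C_def edge_form_def using hk by auto
    then have "B3 (k - 1) k - T (k - 1) k = int p ^ s * (u * v - 1)"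
      using corner3 by (simp add: algebra_simps)
    then show ?thesis using v(1) by simp
  qed
  have upper: "int p ^ r dvd B3 m n - T m n" if "m < n" for m n
  proof -
    consider "n > k" | "n = k" "m = k - 1" | "n = k" "m \<noteq> k - 1" | "n = k - 1" | "n \<le> k - 2"
      by linarith
    then show ?thesis
    proof cases
      case 1
      then have "B3 m n = 0" using supp3[of n m] alternating_onD(1)[OF alt3, of m n] by auto
      moreover have "T m n = 0" using 1 hk unfolding T_def C_def edge_form_def by auto
      ultimately show ?thesis by simp
    next
      case 2
      then show ?thesis using corner by simp
    next
      case 3
      have "T m n = 0" using 3 that hk unfolding T_def C_def edge_form_def by auto
      then show ?thesis using col3[of m] 3 by simp
    next
      case 4
      have "T m n = 0" using 4 that hk unfolding T_def C_def edge_form_def by auto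
      moreover have "B3 m n = - B3 (k - 1) m" using 4 alternating_onD(1)[OF alt3, of m "k - 1"] by simp
      ultimately show ?thesis using row3[of m] 4 that by simp
    next
      case 5
      have "T m n = B3 m n" using 5 that hk unfolding T_def C_def edge_form_def by auto
      then show ?thesis by simp
    qed
  qed
  have "int p ^ r dvd B3 m n - T m n" for m n
  proof (cases m n rule: linorder_cases)
    case less
    then show ?thesis by (rule upper)
  next
    case equal
    then show ?thesis using alternating_onD(2)[OF alt3] alternating_onD(2)[OF altT] by simp
  next
    case greater
    have "B3 m n - T m n = - (B3 n m - T n m)"
      using alternating_onD(1)[OF alt3, of m n] alternating_onD(1)[OF altT, of m n] by simp
    then show ?thesis using upper[OF greater] by (metis dvd_minus_iff)
  qed
  then have step4: "form_step p r K h k B3 T"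
    using altT by (rule form_step.modulo)
  have "(form_step p r K h k)\<^sup>*\<^sup>* B T"
    using step1 step2 step3 step4 by (meson converse_rtranclp_into_rtranclp r_into_rtranclp)
  moreover have "C m n = 0" if "m \<notin> {h..k - 2}" for m n
    using supp3[of m n] that unfolding C_def by auto
  moreover have "int p ^ s dvd C m n" for m n unfolding C_def using dvd3 by simp
  ultimately show ?thesis
    using that[of C] altC hk unfolding T_def by blast
qed

text \<open>Every entry of least valuation meets the head. Replacing \<open>x_(h+1)\<close> clears
  row \<open>h\<close>, but clearing row \<open>h + 1\<close> would require a replacement of
  \<open>x_h\<close>. Those entries stay, and \<open>h + 1\<close> becomes the head of the
  remainder, which contains no entry of valuation \<open>s\<close> any more.\<close>

lemma split_off_head:
  assumes p: "Factorial_Ring.prime p" and "k \<le> K" and alt: "alternating_on K B"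
    and supp: "\<And>m n. m \<notin> {h..k} \<Longrightarrow> B m n = 0"
    and dvd: "\<And>m n. int p ^ s dvd B m n"
    and j: "j \<in> {h<..k}" "\<not> int p ^ Suc s dvd B h j"
    and dvd': "\<And>m n. m \<in> {h<..k} \<Longrightarrow> n \<in> {h<..k} \<Longrightarrow> int p ^ Suc s dvd B m n"
  obtains C where "alternating_on K C" "\<forall>m n. m \<notin> {Suc h..k} \<longrightarrow> C m n = 0"
    "\<forall>m n. int p ^ Suc s dvd C m n" "1 \<le> h" "h < k"
    "(form_step p r K h k)\<^sup>*\<^sup>* B (\<lambda>m n. C m n + edge_form p {h} (\<lambda>_. s) m n)"
proof -
  have hk: "h < k" using j by auto
  \<comment> \<open>Row 0 of an alternating form is zero, so a pivot in row \<open>h\<close>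
    excludes \<open>h = 0\<close>.\<close>
  have h1: "1 \<le> h"
  proof (rule ccontr)
    assume "\<not> 1 \<le> h"
    then have "B h j = 0" using alternating_onD(3)[OF alt, of h j] by auto
    then show False using j(2) by simp
  qed
  define \<pi> where "\<pi> = transpose (Suc h) j"
  have \<pi>: "\<pi> permutes {h<..k}" "\<pi> (Suc h) = j" "\<pi> h = h"
    using j(1) hk unfolding \<pi>_def by (auto intro: permutes_swap_id simp: transpose_def)
  define B1 where "B1 = (\<lambda>m n. B (\<pi> m) (\<pi> n))"
  have step1: "form_step p r K h k B B1"
    unfolding B1_def by (rule form_step.perm[OF \<pi>(1)])
  have alt1: "alternating_on K B1"
    using alternating_on_form_step[OF step1 \<open>k \<le> K\<close> alt] .
  have supp1: "B1 m n = 0" if "m \<notin> {h..k}" for m n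
  proof -
    have "\<pi> m = m" using that \<pi>(1) by (auto intro: permutes_not_in)
    then show ?thesis unfolding B1_def using supp that by simp
  qed
  have dvd1: "int p ^ s dvd B1 m n" for m n unfolding B1_def using dvd .
  have dvd1': "int p ^ Suc s dvd B1 m n" if "m \<in> {h<..k}" "n \<in> {h<..k}" for m n
    unfolding B1_def using that permutes_in_image[OF \<pi>(1)] dvd' by blast
  define D where "D m n = B1 m n div int p ^ s" for m n
  have BD: "B1 m n = int p ^ s * D m n" for m n unfolding D_def using dvd1 by simp
  define u where "u = D h (Suc h)"
  have u: "\<not> int p dvd u"
  proof
    assume "int p dvd u"
    then have "int p ^ Suc s dvd B1 h (Suc h)"
      unfolding BD u_def by (metis dvd_refl mult_dvd_mono power_Suc2)
    then show False using j(2) \<pi> unfolding B1_def by simp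
  qed
  obtain v where v: "int p ^ r dvd u * v - 1" "coprime v (int p)"
    using ex_inverse_mod_prime_power[OF p u] .
  define a where "a n = (if n = Suc h then v else if n = h then 0 else - v * D h n)" for n
  define B2 where "B2 = row_change (Suc h) a B1"
  have D0: "D h n = 0" if "n \<notin> {h..k} \<or> n = 0" for n
    unfolding D_def using supp1[of n h] alternating_onD(4)[OF alt1, of n h]
      alternating_onD(1)[OF alt1, of h n] that by auto
  have step2: "form_step p r K h k B1 B2"
    unfolding B2_def
  proof (rule form_step.row)
    show "Suc h \<in> {h<..k}" using hk by auto
    show "coprime (a (Suc h)) (int p)" unfolding a_def using v(2) by simp
    show "a j = 0" if "j \<notin> {h..k}" for j unfolding a_def using D0[of j] that hk by auto
    show "a 0 = 0" unfolding a_def using D0[of 0] by auto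
  qed
  have alt2: "alternating_on K B2"
    using alternating_on_form_step[OF step2 \<open>k \<le> K\<close> alt1] .
  have supp2: "B2 m n = 0" if "m \<notin> {h..k}" for m n
  proof -
    have "m \<noteq> Suc h" "a m = 0" using that hk D0[of m] unfolding a_def by auto
    then show ?thesis unfolding B2_def row_change_def using supp1[OF that] by simp
  qed
  \<comment> \<open>Replacing \<open>x_(h+1)\<close> combines entries beyond the head only with one
    another, so their divisibility by \<open>p^(s+1)\<close> survives.\<close>
  have dvd2: "int p ^ Suc s dvd B2 m n" if "m \<in> {h<..k}" "n \<in> {h<..k}" for m n
  proof -
    have "Suc h \<in> {h<..k}" using hk by simp
    then have "int p ^ Suc s dvd B1 m n" "int p ^ Suc s dvd B1 m (Suc h)" "int p ^ Suc s dvd B1 (Suc h) n"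
      using that by (blast intro: dvd1')+
    then show ?thesis
      unfolding B2_def row_change_def by (intro dvd_add) (simp_all del: power_Suc)
  qed
  have corner2: "B2 h (Suc h) = int p ^ s * (u * v)"
    unfolding B2_def row_change_def a_def using hk by (simp add: BD u_def)
  have row2: "int p ^ r dvd B2 h n" if "n \<noteq> Suc h" for n
  proof (cases "n = h")
    case True
    then show ?thesis using alternating_onD(2)[OF alt2] by simp
  next
    case False
    then have "B2 h n = - (int p ^ s * D h n) * (u * v - 1)"
      using that hk unfolding B2_def row_change_def a_def by (simp add: BD u_def algebra_simps)
    then show ?thesis using v(1) by simp
  qed
  define C where "C m n = (if m \<in> {h<..} \<and> n \<in> {h<..} then B2 m n else 0)" for m n
  have altC: "alternating_on K C"
    unfolding C_def by (rule alternating_on_restrict[OF alt2])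
  define T where "T m n = C m n + edge_form p {h} (\<lambda>_. s) m n" for m n
  have altT: "alternating_on K T"
    unfolding T_def
    by (intro alternating_on_add altC alternating_on_edge_form) (use hk h1 \<open>k \<le> K\<close> in auto)
  have upper: "int p ^ r dvd B2 m n - T m n" if "m < n" for m n
  proof -
    consider "m < h" | "m = h" "n = Suc h" | "m = h" "n \<noteq> Suc h" | "m > h"
      by linarith
    then show ?thesis
    proof cases
      case 1
      then have "B2 m n = 0" using supp2[of m n] by auto
      moreover have "T m n = 0" using 1 that unfolding T_def C_def edge_form_def by auto
      ultimately show ?thesis by simp
    next
      case 2
      have "T h (Suc h) = int p ^ s" unfolding T_def C_def edge_form_def by auto
      then have "B2 h (Suc h) - T h (Suc h) = int p ^ s * (u * v - 1)"
        by (simp add: corner2 algebra_simps)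
      then show ?thesis using v(1) 2 by simp
    next
      case 3
      have "T m n = 0" using 3 that unfolding T_def C_def edge_form_def by auto
      then show ?thesis using row2[of n] 3 by simp
    next
      case 4
      have "T m n = B2 m n" using 4 that unfolding T_def C_def edge_form_def by auto
      then show ?thesis by simp
    qed
  qed
  have "int p ^ r dvd B2 m n - T m n" for m n
  proof (cases m n rule: linorder_cases)
    case less
    then show ?thesis by (rule upper)
  next
    case equal
    then show ?thesis using alternating_onD(2)[OF alt2] alternating_onD(2)[OF altT] by simp
  next
    case greater
    have "B2 m n - T m n = - (B2 n m - T n m)"
      using alternating_onD(1)[OF alt2, of m n] alternating_onD(1)[OF altT, of m n] by simp
    then show ?thesis using upper[OF greater] by (metis dvd_minus_iff)
  qed
  then have step3: "form_step p r K h k B2 T"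
    using altT by (rule form_step.modulo)
  have "(form_step p r K h k)\<^sup>*\<^sup>* B T"
    using step1 step2 step3 by (meson converse_rtranclp_into_rtranclp r_into_rtranclp)
  moreover have "C m n = 0" if "m \<notin> {Suc h..k}" for m n
    using supp2[of m n] that unfolding C_def by auto
  moreover have "int p ^ Suc s dvd C m n" for m n
  proof (cases "m \<in> {h<..k} \<and> n \<in> {h<..k}")
    case True
    then show ?thesis unfolding C_def using dvd2 by simp
  next
    case False
    then have "C m n = 0"
      using supp2[of m n] supp2[of n m] alternating_onD(1)[OF alt2, of m n] unfolding C_def by auto
    then show ?thesis by simp
  qed
  ultimately show ?thesis
    using that[of C] altC hk h1 unfolding T_def by blast
qed

text \<open>Splitting at an entry of least \<open>p\<close>-adic valuation leaves a smaller form; if every such entry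
  involves the head \<open>h\<close>, its unique neighbour becomes the new head and all later valuations are
  strictly larger. This is why the exponents along the chain increase.\<close>

lemma form_steps_to_edge_form:
  assumes p: "Factorial_Ring.prime p" and "k \<le> K" and "h \<le> k" and "alternating_on K B"
    and "\<And>m n. m \<notin> {h..k} \<Longrightarrow> B m n = 0" and "\<And>m n. int p ^ d dvd B m n"
  shows "\<exists>m q s. h + m + 2 * q \<le> k
    \<and> (\<forall>i j. h \<le> i \<and> i < j \<and> j < h + m \<longrightarrow> s i < s j)
    \<and> (\<forall>e \<in> {h..<h + m} \<union> {e \<in> {k - 2 * q<..<k}. odd (k - e)}. d \<le> s e \<and> s e < r)
    \<and> (form_step p r K h k)\<^sup>*\<^sup>* B
        (edge_form p ({h..<h + m} \<union> {e \<in> {k - 2 * q<..<k}. odd (k - e)}) s)"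
  using assms(2-)
proof (induction "k - h" arbitrary: h k B d rule: less_induct)
  case less
  note alt = less.prems(3) and supp = less.prems(4) and dvd = less.prems(5)
  show ?case
  proof (cases "\<forall>m n. int p ^ r dvd B m n")
    case True
    have "form_step p r K h k B (edge_form p {} (\<lambda>_. 0))"
      by (rule form_step.modulo)
        (use True in \<open>auto simp: edge_form_empty intro: alternating_on_edge_form\<close>,
          simp add: alternating_on_def)
    then have "(form_step p r K h k)\<^sup>*\<^sup>* B (edge_form p {} (\<lambda>_. 0))" by blast
    then show ?thesis
      using less.prems(2) by (intro exI[of _ 0] exI[of _ 0] exI[of _ "\<lambda>_. 0"]) simp
  next
    case False
    \<comment> \<open>The least valuation of an entry. It exists and is below \<open>r\<close>
      because \<open>B\<close> is nonzero modulo \<open>p^r\<close>.\<close>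
    define s where "s = (GREATEST s. \<forall>m n. int p ^ s dvd B m n)"
    have bound: "s' \<le> r" if "\<forall>m n. int p ^ s' dvd B m n" for s'
      using that False by (meson dvd_trans le_imp_power_dvd nat_le_linear)
    have s: "\<forall>m n. int p ^ s dvd B m n"
      unfolding s_def by (rule GreatestI_nat[of _ d r]) (use dvd bound in auto)
    have ds: "d \<le> s"
      unfolding s_def by (rule Greatest_le_nat[of _ d r]) (use dvd bound in auto)
    have "s \<le> r" "s \<noteq> r" using bound s False by auto
    then have sr: "s < r" by simp
    have "\<not> (\<forall>m n. int p ^ Suc s dvd B m n)"
    proof
      assume "\<forall>m n. int p ^ Suc s dvd B m n"
      then have "Suc s \<le> s"
        unfolding s_def by (intro Greatest_le_nat[of _ _ r]) (use bound in auto)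
      then show False by simp
    qed
    then obtain i0 j0 where ij0: "\<not> int p ^ Suc s dvd B i0 j0" by blast
    show ?thesis
    \<comment> \<open>A pivot away from the head gives a pair at the top of the range, and the head
      stays. Otherwise the head is used up and the lower bound for the remaining valuations rises to
      \<open>Suc s\<close>.\<close>
    proof (cases "\<exists>i\<in>{h<..k}. \<exists>j\<in>{h<..k}. \<not> int p ^ Suc s dvd B i j")
      case True
      then obtain i j where ij: "i \<in> {h<..k}" "j \<in> {h<..k}" "\<not> int p ^ Suc s dvd B i j"
        by blast
      obtain C where C: "alternating_on K C" "\<forall>m n. m \<notin> {h..k - 2} \<longrightarrow> C m n = 0"
        "\<forall>m n. int p ^ s dvd C m n" and hk: "h + 2 \<le> k"
        and steps: "(form_step p r K h k)\<^sup>*\<^sup>* B (\<lambda>m n. C m n + edge_form p {k - 1} (\<lambda>_. s) m n)"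
        using split_off_pair[OF p less.prems(1) alt supp s[rule_format] ij] .
      have dC: "int p ^ d dvd C m n" for m n
        using C(3) ds by (meson dvd_trans le_imp_power_dvd)
      have "k - 2 - h < k - h" "k - 2 \<le> K" "h \<le> k - 2" using hk less.prems(1) by auto
      from less.hyps[OF this C(1) C(2)[rule_format] dC] obtain m q t where
        mq: "h + m + 2 * q \<le> k - 2" and incr: "\<forall>i j. h \<le> i \<and> i < j \<and> j < h + m \<longrightarrow> t i < t j"
        and bnd: "\<forall>e \<in> {h..<h + m} \<union> {e \<in> {k - 2 - 2 * q<..<k - 2}. odd (k - 2 - e)}. d \<le> t e \<and> t e < r"
        and steps': "(form_step p r K h (k - 2))\<^sup>*\<^sup>* C
          (edge_form p ({h..<h + m} \<union> {e \<in> {k - 2 - 2 * q<..<k - 2}. odd (k - 2 - e)}) t)"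
        by blast
      define E where "E = {h..<h + m} \<union> {e \<in> {k - 2 - 2 * q<..<k - 2}. odd (k - 2 - e)}"
      define E' where "E' = {h..<h + m} \<union> {e \<in> {k - 2 * Suc q<..<k}. odd (k - e)}"
      have "e \<in> {k - 2 * Suc q<..<k} \<and> odd (k - e) \<longleftrightarrow>
        e = k - 1 \<or> e \<in> {k - 2 - 2 * q<..<k - 2} \<and> odd (k - 2 - e)" for e
      proof -
        consider "e \<ge> k" | "e = k - 1" "e < k" | "e = k - 2" "e < k - 1" | "e < k - 2" by linarith
        then show ?thesis
        proof cases
          case 4
          then have "k - e = Suc (Suc (k - 2 - e))" by simp
          then show ?thesis using 4 by auto
        qed (use hk mq in auto)
      qed
      then have E': "E' = insert (k - 1) E" unfolding E_def E'_def by auto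
      have nE: "k - 1 \<notin> E" unfolding E_def using mq hk by auto
      \<comment> \<open>The remaining moves replace indices up to \<open>k - 2\<close> only, where
        the edge \<open>(k - 1, k)\<close> is zero.\<close>
      have "(form_step p r K h (k - 2))\<^sup>*\<^sup>* (\<lambda>m n. C m n + edge_form p {k - 1} (\<lambda>_. s) m n)
         (\<lambda>m n. edge_form p E t m n + edge_form p {k - 1} (\<lambda>_. s) m n)"
        unfolding E_def
      proof (rule form_steps_add[OF steps'])
        show "alternating_on K (edge_form p {k - 1} (\<lambda>_. s))"
          by (rule alternating_on_edge_form) (use hk less.prems(1) in auto)
        show "edge_form p {k - 1} (\<lambda>_. s) m n = 0" if "m \<in> {h<..k - 2}" for m n
          using that hk unfolding edge_form_def by auto
      qed
      then have "(form_step p r K h k)\<^sup>*\<^sup>* (\<lambda>m n. C m n + edge_form p {k - 1} (\<lambda>_. s) m n)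
         (\<lambda>m n. edge_form p E t m n + edge_form p {k - 1} (\<lambda>_. s) m n)"
        by (rule form_steps_mono) auto
      with steps have "(form_step p r K h k)\<^sup>*\<^sup>* B
         (\<lambda>m n. edge_form p E t m n + edge_form p {k - 1} (\<lambda>_. s) m n)"
        by (rule rtranclp_trans)
      moreover have "(\<lambda>m n. edge_form p E t m n + edge_form p {k - 1} (\<lambda>_. s) m n)
          = edge_form p E' (t(k - 1 := s))"
        unfolding E' by (intro ext edge_form_add[OF nE])
      ultimately have "(form_step p r K h k)\<^sup>*\<^sup>* B (edge_form p E' (t(k - 1 := s)))" by simp
      moreover have "\<forall>e\<in>E'. d \<le> (t(k - 1 := s)) e \<and> (t(k - 1 := s)) e < r"
        using bnd ds sr nE unfolding E' E_def[symmetric] by auto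
      moreover have "h + m + 2 * Suc q \<le> k" using mq hk by simp
      moreover have "\<forall>i j. h \<le> i \<and> i < j \<and> j < h + m \<longrightarrow> (t(k - 1 := s)) i < (t(k - 1 := s)) j"
        using incr mq hk by auto
      ultimately show ?thesis unfolding E'_def by blast
    next
      case False
      have dvd': "int p ^ Suc s dvd B m n" if "m \<in> {h<..k}" "n \<in> {h<..k}" for m n
        using False that by blast
      have B0: "B i0 j0 \<noteq> 0" using ij0 by auto
      then have "i0 \<in> {h..k}" using supp by blast
      moreover have "j0 \<in> {h..k}"
        using B0 supp[of j0 i0] alternating_onD(1)[OF alt, of i0 j0] by auto
      moreover have "i0 \<noteq> j0" using B0 alternating_onD(2)[OF alt] by auto
      moreover have "\<not> int p ^ Suc s dvd B j0 i0"
        using ij0 alternating_onD(1)[OF alt, of i0 j0] by (metis dvd_minus_iff)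
      ultimately obtain j where j: "j \<in> {h<..k}" "\<not> int p ^ Suc s dvd B h j"
        using ij0 dvd' by (metis atLeastAtMost_iff greaterThanAtMost_iff le_neq_implies_less)
      obtain C where C: "alternating_on K C" "\<forall>m n. m \<notin> {Suc h..k} \<longrightarrow> C m n = 0"
        "\<forall>m n. int p ^ Suc s dvd C m n" and hk: "1 \<le> h" "h < k"
        and steps: "(form_step p r K h k)\<^sup>*\<^sup>* B (\<lambda>m n. C m n + edge_form p {h} (\<lambda>_. s) m n)"
        using split_off_head[OF p less.prems(1) alt supp s[rule_format] j dvd'] .
      have "k - Suc h < k - h" "Suc h \<le> k" using hk by auto
      from less.hyps[OF this(1) less.prems(1) this(2) C(1) C(2,3)[rule_format]] obtain m q t where
        mq: "Suc h + m + 2 * q \<le> k"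
        and incr: "\<forall>i j. Suc h \<le> i \<and> i < j \<and> j < Suc h + m \<longrightarrow> t i < t j"
        and bnd: "\<forall>e \<in> {Suc h..<Suc h + m} \<union> {e \<in> {k - 2 * q<..<k}. odd (k - e)}. Suc s \<le> t e \<and> t e < r"
        and steps': "(form_step p r K (Suc h) k)\<^sup>*\<^sup>* C
          (edge_form p ({Suc h..<Suc h + m} \<union> {e \<in> {k - 2 * q<..<k}. odd (k - e)}) t)"
        by blast
      define E where "E = {Suc h..<Suc h + m} \<union> {e \<in> {k - 2 * q<..<k}. odd (k - e)}"
      define E' where "E' = {h..<h + Suc m} \<union> {e \<in> {k - 2 * q<..<k}. odd (k - e)}"
      have E': "E' = insert h E" unfolding E_def E'_def by auto
      have nE: "h \<notin> E" unfolding E_def using mq by auto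
      have "(form_step p r K (Suc h) k)\<^sup>*\<^sup>* (\<lambda>m n. C m n + edge_form p {h} (\<lambda>_. s) m n)
         (\<lambda>m n. edge_form p E t m n + edge_form p {h} (\<lambda>_. s) m n)"
        unfolding E_def
      proof (rule form_steps_add[OF steps'])
        show "alternating_on K (edge_form p {h} (\<lambda>_. s))"
          by (rule alternating_on_edge_form) (use hk less.prems(1) in auto)
        show "edge_form p {h} (\<lambda>_. s) m n = 0" if "m \<in> {Suc h<..k}" for m n
          using that unfolding edge_form_def by auto
      qed
      then have "(form_step p r K h k)\<^sup>*\<^sup>* (\<lambda>m n. C m n + edge_form p {h} (\<lambda>_. s) m n)
         (\<lambda>m n. edge_form p E t m n + edge_form p {h} (\<lambda>_. s) m n)"
        by (rule form_steps_mono) auto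
      with steps have "(form_step p r K h k)\<^sup>*\<^sup>* B
         (\<lambda>m n. edge_form p E t m n + edge_form p {h} (\<lambda>_. s) m n)"
        by (rule rtranclp_trans)
      moreover have "(\<lambda>m n. edge_form p E t m n + edge_form p {h} (\<lambda>_. s) m n)
          = edge_form p E' (t(h := s))"
        unfolding E' by (intro ext edge_form_add[OF nE])
      ultimately have "(form_step p r K h k)\<^sup>*\<^sup>* B (edge_form p E' (t(h := s)))" by simp
      moreover have "\<forall>e\<in>E'. d \<le> (t(h := s)) e \<and> (t(h := s)) e < r"
        using bnd ds sr nE unfolding E' E_def[symmetric] by auto
      moreover have "h + Suc m + 2 * q \<le> k" using mq by simp
      \<comment> \<open>The recursive call was made with lower bound \<open>Suc s\<close>, which
        places the new first exponent strictly below all later ones.\<close>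
      moreover have "(t(h := s)) i < (t(h := s)) j" if "h \<le> i" "i < j" "j < h + Suc m" for i j
      proof (cases "i = h")
        case True
        then have "j \<in> {Suc h..<Suc h + m}" using that by auto
        then have "Suc s \<le> t j" using bnd by blast
        then show ?thesis using True that by simp
      next
        case False
        then show ?thesis using incr that by simp
      qed
      ultimately show ?thesis unfolding E'_def by blast
    qed
  qed
qed

section \<open>From the reduced matrix to the shape of \<open>v_p\<close>\<close>

text \<open>The recursion stores the \<open>q\<close> pairs at the top of the range, while
  \<open>v_p\<close> wants them right after the chain, which ends at vertex \<open>c\<close>. The
  block of \<open>2 * q\<close> paired indices changes places with the block of \<open>d\<close>
  idle ones.\<close>

lemma form_step_rotate:
  fixes c q d :: nat
  assumes "h \<le> c"
  defines "k \<equiv> c + 2 * q + d"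
  shows "form_step p r K h k
    (edge_form p ({h..<c} \<union> {e \<in> {k - 2 * q<..<k}. odd (k - e)}) s)
    (edge_form p ({h..<c} \<union> {e \<in> {c<..<c + 2 * q}. odd (e - c)}) (\<lambda>e. if e < c then s e else s (e + d)))"
    (is "form_step p r K h k (edge_form p ?E s) (edge_form p ?E' ?s)")
proof -
  \<comment> \<open>\<open>\<pi>\<close> sends a new position to the old one, and
    \<open>\<rho>\<close> is its inverse.\<close>
  define \<pi> where "\<pi> i = (if c < i \<and> i \<le> c + 2 * q then i + d
    else if c + 2 * q < i \<and> i \<le> k then i - 2 * q else i)" for i
  define \<rho> where "\<rho> i = (if c < i \<and> i \<le> c + d then i + 2 * q
    else if c + d < i \<and> i \<le> k then i - d else i)" for i
  have \<pi>\<rho>: "\<pi> (\<rho> i) = i" and \<rho>\<pi>: "\<rho> (\<pi> i) = i" for i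
    unfolding \<pi>_def \<rho>_def k_def by auto
  have perm: "\<pi> permutes {h<..k}"
    unfolding permutes_def
  proof (intro conjI allI impI)
    show "\<pi> x = x" if "x \<notin> {h<..k}" for x
      using that assms(1) unfolding \<pi>_def k_def by auto
    show "\<exists>!x. \<pi> x = y" for y
      using \<pi>\<rho> \<rho>\<pi> by metis
  qed
  \<comment> \<open>Adjacency can break only at the ends of the blocks, which carry no edges, or
    among idle indices.\<close>
  have edge: "\<pi> j = Suc (\<pi> i) \<and> \<pi> i \<in> ?E \<longleftrightarrow> j = Suc i \<and> i \<in> ?E'" for i j
  proof -
    consider "i < c" | "i = c" | "c < i" "i < c + 2 * q" | "i = c + 2 * q" "c < i" | "c + 2 * q < i" by linarith
    then show ?thesis
    proof cases
      case 1
      then have "\<pi> i = i" unfolding \<pi>_def by simp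
      moreover have "\<pi> j = Suc i \<longleftrightarrow> j = Suc i" using 1 unfolding \<pi>_def by auto
      ultimately show ?thesis using 1 unfolding k_def by auto
    next
      case 2
      then have "\<pi> i = c" unfolding \<pi>_def by simp
      then show ?thesis using 2 unfolding k_def by auto
    next
      case 3
      then have \<pi>i: "\<pi> i = i + d" unfolding \<pi>_def by simp
      have "\<pi> j = Suc (i + d) \<longleftrightarrow> j = Suc i"
      proof -
        have "\<pi> (Suc i) = Suc (i + d)" using 3 unfolding \<pi>_def by simp
        then show ?thesis using \<rho>\<pi> by metis
      qed
      moreover have "odd (k - (i + d)) \<longleftrightarrow> odd (i - c)"
        using 3 unfolding k_def by auto
      ultimately show ?thesis using 3 \<pi>i unfolding k_def by auto
    next
      case 4
      then have "\<pi> i = k" unfolding \<pi>_def k_def by simp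
      then show ?thesis using 4 unfolding k_def by auto
    next
      case 5
      then have "c < \<pi> i" "\<pi> i \<le> k - 2 * q \<or> k < \<pi> i" unfolding \<pi>_def k_def by auto
      then show ?thesis using 5 unfolding k_def by auto
    qed
  qed
  have s: "s (\<pi> i) = ?s i" if "i \<in> ?E'" for i
    using that unfolding \<pi>_def by auto
  have "edge_form p ?E s (\<pi> i) (\<pi> j) = edge_form p ?E' ?s i j" for i j
    unfolding edge_form_def edge using s by auto
  then have "edge_form p ?E' ?s = (\<lambda>i j. edge_form p ?E s (\<pi> i) (\<pi> j))" by (intro ext) simp
  then show ?thesis using form_step.perm[OF perm] by simp
qed

lemma form_steps_to_chain_and_pairs:
  assumes p: "Factorial_Ring.prime p" and "h \<le> k" and alt: "alternating_on k B"
    and supp: "\<forall>m n. m \<notin> {h..k} \<longrightarrow> B m n = 0"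
  shows "\<exists>m q s. h + m + 2 * q \<le> k
    \<and> (\<forall>i j. h \<le> i \<and> i < j \<and> j < h + m \<longrightarrow> s i < s j)
    \<and> (\<forall>e \<in> {h..<h + m} \<union> {e \<in> {h + m<..<h + m + 2 * q}. odd (e - (h + m))}. s e < r)
    \<and> (form_step p r k h k)\<^sup>*\<^sup>* B
      (edge_form p ({h..<h + m} \<union> {e \<in> {h + m<..<h + m + 2 * q}. odd (e - (h + m))}) s)"
proof -
  have "int p ^ 0 dvd B i j" for i j by simp
  from form_steps_to_edge_form[OF p order_refl \<open>h \<le> k\<close> alt supp[rule_format] this] obtain m q s where
    mq: "h + m + 2 * q \<le> k" and incr: "\<forall>i j. h \<le> i \<and> i < j \<and> j < h + m \<longrightarrow> s i < s j"
    and bnd: "\<forall>e \<in> {h..<h + m} \<union> {e \<in> {k - 2 * q<..<k}. odd (k - e)}. 0 \<le> s e \<and> s e < r"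
    and steps: "(form_step p r k h k)\<^sup>*\<^sup>* B
        (edge_form p ({h..<h + m} \<union> {e \<in> {k - 2 * q<..<k}. odd (k - e)}) s)"
    by blast
  define c d where "c = h + m" and "d = k - (c + 2 * q)"
  have k: "k = c + 2 * q + d" using mq unfolding c_def d_def by simp
  let ?s = "\<lambda>e. if e < c then s e else s (e + d)"
  show ?thesis
  proof (rule exI[of _ m], rule exI[of _ q], rule exI[of _ ?s], intro conjI allI impI ballI,
      unfold c_def[symmetric])
    show "c + 2 * q \<le> k" using mq unfolding c_def .
    have "h \<le> c" unfolding c_def by simp
    from form_step_rotate[OF this, of p r k q d s]
    show "(form_step p r k h k)\<^sup>*\<^sup>* B
        (edge_form p ({h..<c} \<union> {e \<in> {c<..<c + 2 * q}. odd (e - c)}) ?s)"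
      unfolding k[symmetric]
      by (rule rtranclp.rtrancl_into_rtrancl[OF steps[folded c_def]])
  next
    fix e assume e: "e \<in> {h..<c} \<union> {e \<in> {c<..<c + 2 * q}. odd (e - c)}"
    show "?s e < r"
    proof (cases "e < c")
      case True
      then show ?thesis using e bnd unfolding c_def[symmetric] by auto
    next
      case False
      then have e': "c < e" "e < c + 2 * q" "odd (e - c)" using e by auto
      then have "odd (k - (e + d))" unfolding k by auto
      then have "e + d \<in> {e \<in> {k - 2 * q<..<k}. odd (k - e)}" using e' unfolding k by auto
      then show ?thesis using bnd False by auto
    qed
  next
    fix i j assume "h \<le> i \<and> i < j \<and> j < c"
    then show "?s i < ?s j" using incr unfolding c_def by simp
  qed
qed

text \<open>The \<open>j\<close> for which a power of \<open>[x\<^sub>j, x\<^sub>j\<^sub>+\<^sub>1]\<close> occurs in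
  \<open>v\<^sub>p(t\<^sub>0, \<ell>; s\<^sub>1, \<dots>, s\<^sub>n\<^sub>-\<^sub>1)\<close>.\<close>

definition v_edges :: "nat \<Rightarrow> nat \<Rightarrow> nat set" where
  "v_edges l n = {1..<l} \<union> {j \<in> {l..<n}. even (j - l)}"

text \<open>With the fictitious index 0 as head, all of \<open>x_1, ..., x_k\<close> may be
  replaced. The chain starting at the head must then be empty, since row 0 stays zero, and only
  isolated pairs remain.\<close>

lemma form_steps_to_v_edges_free:
  assumes p: "Factorial_Ring.prime p" and "1 \<le> k" and alt: "alternating_on k B"
  obtains n s where "1 \<le> n" "n \<le> k" "(form_step p r k 0 k)\<^sup>*\<^sup>* B (edge_form p (v_edges 1 n) s)"
proof -
  have supp: "\<forall>m n. m \<notin> {0..k} \<longrightarrow> B m n = 0"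
    using alternating_onD(3)[OF alt] by auto
  obtain m q s where mq: "0 + m + 2 * q \<le> k"
    and steps: "(form_step p r k 0 k)\<^sup>*\<^sup>* B
      (edge_form p ({0..<0 + m} \<union> {e \<in> {0 + m<..<0 + m + 2 * q}. odd (e - (0 + m))}) s)"
    using form_steps_to_chain_and_pairs[OF p le0 alt supp, of r] by (elim exE conjE) (rule that)
  let ?E = "{0..<m} \<union> {e \<in> {m<..<m + 2 * q}. odd (e - m)}"
  have "m = 0"
  proof (rule ccontr)
    assume "m \<noteq> 0"
    then have "edge_form p ?E s 0 1 = int p ^ s 0" unfolding edge_form_def by simp
    moreover have "edge_form p ?E s 0 1 = 0"
      using alternating_onD(3)[OF alternating_on_form_steps[OF steps order_refl alt], of 0 1] by simp
    ultimately show False using p by (simp add: prime_gt_0_nat)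
  qed
  \<comment> \<open>\<open>max 1\<close> keeps \<open>n\<close> positive when there are no pairs;
    \<open>v_edges 1 1\<close> is empty.\<close>
  moreover have "{e \<in> {0<..<2 * q}. odd e} = v_edges 1 (max 1 (2 * q))"
    unfolding v_edges_def by auto
  ultimately have "(form_step p r k 0 k)\<^sup>*\<^sup>* B (edge_form p (v_edges 1 (max 1 (2 * q))) s)"
    using steps by simp
  then show ?thesis using that[of "max 1 (2 * q)" s] mq \<open>1 \<le> k\<close> by auto
qed

text \<open>In \<open>v_p\<close> the last edge of a chain of \<open>m\<close> edges counts as the
  first factor of the second product, whence \<open>l = m\<close>. A nonempty edge set of
  \<open>v_p\<close> always contains the edge 1, so an isolated head followed by pairs needs
  separate treatment.\<close>

lemma form_steps_to_v_edges_head: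
  assumes p: "Factorial_Ring.prime p" and "1 \<le> k" and alt: "alternating_on k B"
  obtains l n s where "1 \<le> l" "l \<le> n" "n \<le> k"
    "\<forall>i j. 1 \<le> i \<and> i < j \<and> j < l \<longrightarrow> s i < s j" "\<forall>i\<in>v_edges l n. s i < r"
    "(form_step p r k 1 k)\<^sup>*\<^sup>* B (edge_form p (v_edges l n) s)"
proof -
  have supp: "\<forall>m n. m \<notin> {1..k} \<longrightarrow> B m n = 0"
    using alternating_onD(3)[OF alt] by blast
  obtain m q s where mq: "1 + m + 2 * q \<le> k"
    and incr: "\<And>i j. 1 \<le> i \<Longrightarrow> i < j \<Longrightarrow> j < 1 + m \<Longrightarrow> s i < s j"
    and bnd: "\<And>e. e \<in> {1..<1 + m} \<union> {e \<in> {1 + m<..<1 + m + 2 * q}. odd (e - (1 + m))} \<Longrightarrow> s e < r"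
    and steps: "(form_step p r k 1 k)\<^sup>*\<^sup>* B
      (edge_form p ({1..<1 + m} \<union> {e \<in> {1 + m<..<1 + m + 2 * q}. odd (e - (1 + m))}) s)"
    using form_steps_to_chain_and_pairs[OF p \<open>1 \<le> k\<close> alt supp, of r] by blast
  show ?thesis
  proof (cases "m = 0")
    case False
    have "{1..<1 + m} \<union> {e \<in> {1 + m<..<1 + m + 2 * q}. odd (e - (1 + m))} = v_edges m (1 + m + 2 * q)"
    proof -
      have "e \<in> {1..<1 + m} \<union> {e \<in> {1 + m<..<1 + m + 2 * q}. odd (e - (1 + m))}
          \<longleftrightarrow> e \<in> v_edges m (1 + m + 2 * q)" for e
      proof -
        consider "e < m" | "e = m" | "e = Suc m" | t where "e = Suc (Suc (m + t))"
          by (metis Suc_lessI less_imp_Suc_add linorder_neqE_nat add_Suc_right add_Suc)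
        then show ?thesis unfolding v_edges_def using False by cases auto
      qed
      then show ?thesis by blast
    qed
    then show ?thesis
      using that[of m "1 + m + 2 * q" s] False mq incr bnd steps by auto
  next
    case True
    define E where "E = {e \<in> {1<..<1 + 2 * q}. odd (e - 1)}"
    have steps: "(form_step p r k 1 k)\<^sup>*\<^sup>* B (edge_form p E s)"
      using steps True unfolding E_def by simp
    show ?thesis
    proof (cases "q = 0")
      case True
      then have "E = v_edges 1 1" unfolding E_def v_edges_def by auto
      then show ?thesis using that[of 1 1 s] steps \<open>1 \<le> k\<close> by (simp add: v_edges_def)
    next
      case False
      \<comment> \<open>The head is isolated. As \<open>[x\<^sub>2, x\<^sub>3 x\<^sub>1\<inverse>] = [x\<^sub>1, x\<^sub>2][x\<^sub>2, x\<^sub>3]\<close> in class two, it can be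
        attached to the first pair.\<close>
      define a :: "nat \<Rightarrow> int" where "a j = (if j = 3 then 1 else if j = 1 then - 1 else 0)" for j
      have k3: "3 \<le> k" using mq False by simp
      have E: "2 \<in> E" "3 \<notin> E" "1 \<notin> E" "0 \<notin> E" using False unfolding E_def by auto
      have "row_change 3 a (edge_form p E s) = edge_form p (insert 1 E) (s(1 := s 2))"
      proof (intro ext)
        fix i j
        have e3: "edge_form p E s n 3 = (if n = 2 then int p ^ s 2 else 0)"
          "edge_form p E s 3 n = (if n = 2 then - (int p ^ s 2) else 0)" for n
          using E unfolding edge_form_def by (auto simp: numeral_eq_Suc)
        have e1: "edge_form p E s 1 n = 0" "edge_form p E s n 1 = 0" for n
          using E unfolding edge_form_def by auto
        have "edge_form p (insert 1 E) (s(1 := s 2)) i j = edge_form p E s i j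
          + (if i = 1 \<and> j = 2 then int p ^ s 2 else if i = 2 \<and> j = 1 then - (int p ^ s 2) else 0)"
        proof -
          consider "j = Suc i" | "i = Suc j" | "j \<noteq> Suc i" "i \<noteq> Suc j" by blast
          then show ?thesis using E by cases (auto simp: edge_form_def)
        qed
        then show "row_change 3 a (edge_form p E s) i j = edge_form p (insert 1 E) (s(1 := s 2)) i j"
          unfolding row_change_def e3 a_def using e3 by (auto simp: e1)
      qed
      moreover have "form_step p r k 1 k (edge_form p E s) (row_change 3 a (edge_form p E s))"
        by (rule form_step.row) (use k3 in \<open>auto simp: a_def\<close>)
      moreover have E2: "insert 1 E = v_edges 2 (1 + 2 * q)"
      proof -
        have "e \<in> insert 1 E \<longleftrightarrow> e \<in> v_edges 2 (1 + 2 * q)" for e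
        proof -
          consider "e = 0" | "e = 1" | t where "e = Suc (Suc t)"
            by (metis One_nat_def not0_implies_Suc)
          then show ?thesis unfolding E_def v_edges_def using False by cases auto
        qed
        then show ?thesis by blast
      qed
      ultimately have "(form_step p r k 1 k)\<^sup>*\<^sup>* B (edge_form p (v_edges 2 (1 + 2 * q)) (s(1 := s 2)))"
        using steps by (metis rtranclp.rtrancl_into_rtrancl)
      moreover have "\<forall>i\<in>v_edges 2 (1 + 2 * q). (s(1 := s 2)) i < r"
        using bnd E True E2[symmetric] unfolding E_def by auto
      \<comment> \<open>For \<open>l = 2\<close> the condition of strict increase concerns the
        single index 1, so the equal exponents at 1 and 2 are admissible.\<close>
      ultimately show ?thesis
        using that[of 2 "1 + 2 * q" "s(1 := s 2)"] False mq by auto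
    qed
  qed
qed

section \<open>Products of powers in abelian groups\<close>

lemma (in comm_group) finprod_int_pow:
  assumes "f \<in> A \<rightarrow> carrier G"
  shows "(\<Otimes>x\<in>A. f x) [^] (n::int) = (\<Otimes>x\<in>A. f x [^] n)"
proof (cases "finite A")
  case True
  then show ?thesis
    using assms
  proof (induction A)
    case (insert a A)
    then show ?case by (simp add: Pi_def int_pow_distrib)
  qed simp
qed simp

lemma (in comm_group) int_pow_sum:
  assumes "z \<in> carrier G" and "finite A"
  shows "z [^] (\<Sum>x\<in>A. a x :: int) = (\<Otimes>x\<in>A. z [^] a x)"
  using assms(2)
  by (induction A) (use assms(1) in \<open>simp_all add: Pi_def int_pow_mult\<close>)

lemma (in comm_monoid) finprod_swap:
  assumes "finite A" "finite B" and "\<And>x y. x \<in> A \<Longrightarrow> y \<in> B \<Longrightarrow> f x y \<in> carrier G"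
  shows "(\<Otimes>x\<in>A. \<Otimes>y\<in>B. f x y) = (\<Otimes>y\<in>B. \<Otimes>x\<in>A. f x y)"
  using assms(1,3)
proof (induction A)
  case (insert a A)
  have cl: "(\<lambda>y. f a y) \<in> B \<rightarrow> carrier G" "(\<lambda>y. \<Otimes>x\<in>A. f x y) \<in> B \<rightarrow> carrier G"
    "(\<lambda>x. \<Otimes>y\<in>B. f x y) \<in> A \<rightarrow> carrier G" "(\<Otimes>y\<in>B. f a y) \<in> carrier G"
    using insert.prems by (auto intro!: finprod_closed)
  have "(\<Otimes>x\<in>insert a A. \<Otimes>y\<in>B. f x y) = (\<Otimes>y\<in>B. f a y) \<otimes> (\<Otimes>x\<in>A. \<Otimes>y\<in>B. f x y)"
    using insert.hyps cl by simp
  also have "\<dots> = (\<Otimes>y\<in>B. f a y) \<otimes> (\<Otimes>y\<in>B. \<Otimes>x\<in>A. f x y)"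
    using insert.IH insert.prems by simp
  also have "\<dots> = (\<Otimes>y\<in>B. f a y \<otimes> (\<Otimes>x\<in>A. f x y))"
    using finprod_multf[OF cl(1,2)] by simp
  also have "\<dots> = (\<Otimes>y\<in>B. \<Otimes>x\<in>insert a A. f x y)"
  proof (rule finprod_cong')
    show "f a y \<otimes> (\<Otimes>x\<in>A. f x y) = (\<Otimes>x\<in>insert a A. f x y)" if "y \<in> B" for y
      using insert.hyps insert.prems that by (subst finprod_insert) auto
  qed (use insert.prems in \<open>auto intro!: finprod_closed\<close>)
  finally show ?case .
qed simp

text \<open>Nested products of powers compose like a matrix acting on a vector of exponents. With
  index pairs in place of indices, this expands commutators of substituted words.\<close>

lemma (in comm_group) finprod_pow_linear:
  assumes "finite P" "finite R" and z: "z \<in> R \<rightarrow> carrier G"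
  shows "(\<Otimes>x\<in>P. (\<Otimes>y\<in>R. z y [^] (c x y :: int)) [^] (U x :: int))
    = (\<Otimes>y\<in>R. z y [^] (\<Sum>x\<in>P. c x y * U x))"
proof -
  have cl: "\<And>y (n::int). y \<in> R \<Longrightarrow> z y [^] n \<in> carrier G" using z by auto
  have "(\<Otimes>x\<in>P. (\<Otimes>y\<in>R. z y [^] c x y) [^] U x) = (\<Otimes>x\<in>P. \<Otimes>y\<in>R. z y [^] (c x y * U x))"
  proof (rule finprod_cong')
    fix x
    have "(\<Otimes>y\<in>R. z y [^] c x y) [^] U x = (\<Otimes>y\<in>R. (z y [^] c x y) [^] U x)"
      by (rule finprod_int_pow) (use cl in auto)
    also have "\<dots> = (\<Otimes>y\<in>R. z y [^] (c x y * U x))"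
      by (rule finprod_cong') (use z in \<open>auto simp: int_pow_pow Pi_def\<close>)
    finally show "(\<Otimes>y\<in>R. z y [^] c x y) [^] U x = (\<Otimes>y\<in>R. z y [^] (c x y * U x))" .
  qed (use cl in \<open>auto intro!: finprod_closed\<close>)
  also have "\<dots> = (\<Otimes>y\<in>R. \<Otimes>x\<in>P. z y [^] (c x y * U x))"
    by (rule finprod_swap[OF assms(1,2)]) (use cl in auto)
  also have "\<dots> = (\<Otimes>y\<in>R. z y [^] (\<Sum>x\<in>P. c x y * U x))"
    by (rule finprod_cong') (use z assms in \<open>auto simp: int_pow_sum Pi_def\<close>)
  finally show ?thesis .
qed

lemma (in comm_group) finprod_pow_add:
  assumes "z \<in> P \<rightarrow> carrier G"
  shows "(\<Otimes>x\<in>P. z x [^] (U x + V x :: int)) = (\<Otimes>x\<in>P. z x [^] U x) \<otimes> (\<Otimes>x\<in>P. z x [^] V x)"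
proof -
  have "(\<Otimes>x\<in>P. z x [^] (U x + V x :: int)) = (\<Otimes>x\<in>P. z x [^] U x \<otimes> z x [^] V x)"
    by (rule finprod_cong') (use assms in \<open>auto simp: int_pow_mult Pi_def\<close>)
  also have "\<dots> = (\<Otimes>x\<in>P. z x [^] U x) \<otimes> (\<Otimes>x\<in>P. z x [^] V x)"
    by (rule finprod_multf) (use assms in auto)
  finally show ?thesis .
qed

lemma (in comm_group) finprod_pow_single:
  assumes "finite P" "z \<in> P \<rightarrow> carrier G" "a \<in> P" "\<And>x. x \<in> P \<Longrightarrow> x \<noteq> a \<Longrightarrow> U x = (0::int)"
  shows "(\<Otimes>x\<in>P. z x [^] U x) = z a [^] U a"
proof -
  have "(\<Otimes>x\<in>P. z x [^] U x) = (\<Otimes>x\<in>P. if a = x then z x [^] U x else \<one>)"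
    by (rule finprod_cong') (use assms in \<open>auto simp: Pi_def\<close>)
  also have "\<dots> = z a [^] U a"
    by (rule finprod_singleton) (use assms in auto)
  finally show ?thesis .
qed

text \<open>The factors at \<open>(i, j)\<close> and \<open>(j, i)\<close> combine to
  \<open>z i j\<close> raised to \<open>V i j - V j i\<close>, a multiple of the exponent
  \<open>M\<close>. This is why only the alternating part of an exponent matrix matters.\<close>

lemma (in comm_group) finprod_pow_symmetric:
  fixes I :: "nat set"
  assumes "finite I" and z: "\<And>i j. i \<in> I \<Longrightarrow> j \<in> I \<Longrightarrow> z i j \<in> carrier G"
    and diag: "\<And>i. i \<in> I \<Longrightarrow> z i i = \<one>"
    and skew: "\<And>i j. i \<in> I \<Longrightarrow> j \<in> I \<Longrightarrow> z j i = inv (z i j)"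
    and exponent: "\<And>i j. i \<in> I \<Longrightarrow> j \<in> I \<Longrightarrow> z i j [^] (M::int) = \<one>"
    and V: "\<And>i j. i \<in> I \<Longrightarrow> j \<in> I \<Longrightarrow> M dvd V i j - V j i"
  shows "finprod G (\<lambda>(i, j). z i j [^] (V i j :: int)) (I \<times> I) = \<one>"
proof -
  let ?f = "\<lambda>(i, j). z i j [^] (V i j :: int)"
  let ?U = "{(i, j) \<in> I \<times> I. i < j}" and ?L = "{(i, j) \<in> I \<times> I. j < i}" and ?D = "{(i, j) \<in> I \<times> I. i = j}"
  have fin: "finite ?U" "finite ?L" "finite ?D"
    using assms(1) by (auto intro: finite_subset[of _ "I \<times> I"])
  have "I \<times> I = (?U \<union> ?L) \<union> ?D" by auto
  then have "finprod G ?f (I \<times> I) = finprod G ?f ((?U \<union> ?L) \<union> ?D)"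
    by (rule arg_cong)
  also have "\<dots> = finprod G ?f (?U \<union> ?L) \<otimes> finprod G ?f ?D"
    by (rule finprod_Un_disjoint) (use fin z in auto)
  also have "finprod G ?f ?D = \<one>"
    by (rule finprod_one_eqI) (use diag in auto)
  also have "finprod G ?f (?U \<union> ?L) = finprod G ?f ?U \<otimes> finprod G ?f ?L"
  proof (rule finprod_Un_disjoint[OF fin(1,2)])
    show "?U \<inter> ?L = {}" by auto
  qed (use z in auto)
  also have "finprod G ?f ?L = finprod G ?f (prod.swap ` ?U)"
    by (rule arg_cong[where f = "finprod G ?f"]) (auto simp: image_iff)
  also have "\<dots> = (\<Otimes>x\<in>?U. ?f (prod.swap x))"
    by (rule finprod_reindex) (use z in \<open>auto intro!: inj_onI\<close>)
  also have "finprod G ?f ?U \<otimes> (\<Otimes>x\<in>?U. ?f (prod.swap x)) = (\<Otimes>x\<in>?U. ?f x \<otimes> ?f (prod.swap x))"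
    by (rule finprod_multf[symmetric]) (use z in auto)
  also have "\<dots> = \<one>"
  proof (rule finprod_one_eqI)
    fix x assume "x \<in> ?U"
    then obtain i j where x: "x = (i, j)" and ij: "i \<in> I" "j \<in> I" by auto
    obtain t where t: "V i j - V j i = M * t" using V[OF ij] by (auto elim: dvdE)
    have "?f x \<otimes> ?f (prod.swap x) = z i j [^] V i j \<otimes> inv (z i j) [^] V j i"
      using skew[OF ij] x by simp
    also have "\<dots> = z i j [^] (V i j - V j i)"
      using z[OF ij] by (simp add: int_pow_diff int_pow_inv)
    also have "\<dots> = \<one>"
      using z[OF ij] exponent[OF ij] by (simp add: t flip: int_pow_pow)
    finally show "?f x \<otimes> ?f (prod.swap x) = \<one>" .
  qed
  finally show ?thesis by simp
qed

section \<open>Exponent sums and substitution\<close>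

text \<open>The coordinates of the image in the abelianisation Z^k. In class two they determine the
  commutator of two word values.\<close>

fun exps :: "letter list \<Rightarrow> nat \<Rightarrow> int" where
  "exps [] i = 0"
| "exps ((j, b) # w) i = (if i = j then if b then - 1 else 1 else 0) + exps w i"

lemma exps_append: "exps (u @ v) i = exps u i + exps v i"
  by (induction u) auto

lemma exps_inv_word: "exps (inv_word w) i = - exps w i"
  unfolding inv_word_def by (induction w) (auto simp: exps_append)

lemma words_append: "u @ v \<in> words k \<longleftrightarrow> u \<in> words k \<and> v \<in> words k"
  unfolding words_def by auto

lemma words_Nil: "[] \<in> words k"
  unfolding words_def by auto

lemma words_Cons: "(i, b) # w \<in> words k \<longleftrightarrow> i \<in> {1..k} \<and> w \<in> words k"
  unfolding words_def by auto

lemma words_concat: "concat ws \<in> words k \<longleftrightarrow> set ws \<subseteq> words k"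
  by (induction ws) (auto simp: words_append words_Nil)

lemma words_inv_word: "inv_word w \<in> words k \<longleftrightarrow> w \<in> words k"
  unfolding inv_word_def words_def by (force simp: lists_eq_set)

definition subst_word :: "(nat \<Rightarrow> letter list) \<Rightarrow> letter list \<Rightarrow> letter list" where
  "subst_word u w = concat (map (\<lambda>(i, b). if b then inv_word (u i) else u i) w)"

lemma subst_word_Cons:
  "subst_word u ((i, b) # w) = (if b then inv_word (u i) else u i) @ subst_word u w"
  unfolding subst_word_def by simp

lemma subst_word_in_words:
  assumes "\<forall>i\<in>{1..k}. u i \<in> words k" and "w \<in> words k"
  shows "subst_word u w \<in> words k"
  using assms(2)
proof (induction w)
  case Nil
  then show ?case by (simp add: subst_word_def words_Nil)
next
  case (Cons l w)
  then show ?case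
    using assms(1) by (cases l) (auto simp: subst_word_Cons words_Cons words_append words_inv_word)
qed

lemma exps_subst_word:
  assumes "w \<in> words k"
  shows "exps (subst_word u w) j = (\<Sum>i\<in>{1..k}. exps w i * exps (u i) j)"
  using assms
proof (induction w)
  case Nil
  then show ?case by (simp add: subst_word_def)
next
  case (Cons l w)
  obtain i b where l: "l = (i, b)" by (cases l)
  then have i: "i \<in> {1..k}" and w: "w \<in> words k" using Cons.prems by (simp_all add: words_Cons)
  have "(\<Sum>m\<in>{1..k}. (if m = i then if b then - 1 else 1 else 0) * exps (u m) j)
      = (\<Sum>m\<in>{1..k}. if i = m then (if b then - exps (u m) j else exps (u m) j) else 0)"
    by (rule sum.cong) auto
  also have "\<dots> = (if b then - exps (u i) j else exps (u i) j)"
    using i by simp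
  finally show ?case
    using Cons.IH[OF w] unfolding l
    by (simp add: subst_word_Cons exps_append exps_inv_word distrib_right sum.distrib)
qed

section \<open>Ordered monomials and their exponent sums\<close>

definition gen_pow :: "nat \<Rightarrow> int \<Rightarrow> letter list" where
  "gen_pow i n = replicate (nat \<bar>n\<bar>) (i, n < 0)"

definition monomial_word :: "(nat \<Rightarrow> int) \<Rightarrow> nat \<Rightarrow> letter list" where
  "monomial_word a n = concat (map (\<lambda>i. gen_pow i (a i)) [1..<Suc n])"

lemma gen_pow_in_words: "i \<in> {1..k} \<Longrightarrow> gen_pow i n \<in> words k"
  unfolding gen_pow_def words_def by auto

lemma exps_gen_pow: "exps (gen_pow i n) j = (if j = i then n else 0)"
proof -
  have "exps (replicate m (i, b)) j = (if j = i then (if b then - int m else int m) else 0)" for m b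
    by (induction m) auto
  then show ?thesis unfolding gen_pow_def by auto
qed

lemma gen_in_words: "i \<in> {1..k} \<Longrightarrow> gen i \<in> words k"
  unfolding gen_def by (simp add: words_Cons words_Nil)

lemma exps_gen: "exps (gen i) j = (if j = i then 1 else 0)"
  unfolding gen_def by simp

lemma monomial_word_0: "monomial_word a 0 = []"
  unfolding monomial_word_def by simp

lemma monomial_word_Suc: "monomial_word a (Suc n) = monomial_word a n @ gen_pow (Suc n) (a (Suc n))"
  unfolding monomial_word_def by simp

lemma monomial_word_in_words: "n \<le> k \<Longrightarrow> monomial_word a n \<in> words k"
  by (induction n) (auto simp: monomial_word_0 monomial_word_Suc words_Nil words_append gen_pow_in_words)

lemma exps_monomial_word: "exps (monomial_word a n) j = (if j \<in> {1..n} then a j else 0)"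
  by (induction n) (auto simp: monomial_word_0 monomial_word_Suc exps_append exps_gen_pow)

lemma monomial_word_cong: "(\<And>i. i \<in> {1..n} \<Longrightarrow> a i = b i) \<Longrightarrow> monomial_word a n = monomial_word b n"
  unfolding monomial_word_def by (intro arg_cong[where f = concat] map_cong) auto

lemma letters_monomial_word: "(j, b) \<in> set (monomial_word a n) \<Longrightarrow> a j \<noteq> 0 \<and> j \<in> {1..n}"
  unfolding monomial_word_def gen_pow_def by (auto split: if_splits)

text \<open>One coordinate of the row vector \<open>f\<close> times the identity matrix with row
  \<open>i\<close> replaced; \<open>c\<close> is the entry of the new row in column
  \<open>y\<close>.\<close>

lemma sum_replaced_row:
  fixes f :: "'b \<Rightarrow> int"
  assumes "finite A" "i \<in> A" "y \<in> A"
  shows "(\<Sum>n\<in>A. f n * (if n = i then c else if y = n then 1 else 0)) = (if y = i then 0 else f y) + c * f i"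
proof -
  let ?e = "\<lambda>n. if n = i then c else if y = n then 1 else 0"
  have "(\<Sum>n\<in>A. f n * ?e n) = f i * ?e i + (\<Sum>n\<in>A - {i}. f n * ?e n)"
    using assms by (intro sum.remove) auto
  also have "(\<Sum>n\<in>A - {i}. f n * ?e n) = (\<Sum>n\<in>A - {i}. if y = n then f n else 0)"
    by (rule sum.cong) auto
  finally show ?thesis using assms by (simp add: sum.delta')
qed

section \<open>Exponent sums vanish on the commutator subgroup\<close>

lemma exps_free_equiv:
  assumes "free_equiv w w'"
  shows "exps w i = exps w' i"
proof -
  have step: "exps u i = exps v i" if "free_step u v" for u v
    using that by cases (auto simp: exps_append)
  show ?thesis
    using assms unfolding free_equiv_def
    by (induction rule: rtranclp_induct) (auto dest: step)
qed

lemma exps_in_commutator_subgroup: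
  assumes "in_commutator_subgroup k w"
  shows "exps w i = 0"
proof -
  obtain cs where "free_equiv w (concat (map (\<lambda>(u, v). comm_word u v) cs))"
    using assms unfolding in_commutator_subgroup_def by blast
  then have "exps w i = exps (concat (map (\<lambda>(u, v). comm_word u v) cs)) i"
    by (rule exps_free_equiv)
  also have "\<dots> = 0"
    by (induction cs) (auto simp: exps_append exps_inv_word comm_word_def)
  finally show ?thesis .
qed

lemma edge_form_cong: "(\<And>e. e \<in> E \<Longrightarrow> s e = t e) \<Longrightarrow> edge_form p E s = edge_form p E t"
  unfolding edge_form_def by (intro ext) simp

section \<open>Word maps on \<open>p\<close>-groups of class two\<close>

text \<open>Class two is recorded as centrality of commutators, and \<open>N\<close> supplies the
  modulus: as \<open>|G| = p^N\<close>, exponents matter only modulo \<open>p^N\<close>.\<close>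

locale p_group_class_two = group G for G (structure) +
  fixes p N k :: nat
  assumes prime_p: "Factorial_Ring.prime p"
    and card_carrier: "card (carrier G) = p ^ N"
    and finite_carrier: "finite (carrier G)"
    and commutator_central: "x \<in> carrier G \<Longrightarrow> y \<in> carrier G \<Longrightarrow> z \<in> carrier G \<Longrightarrow>
      x \<otimes> y \<otimes> inv x \<otimes> inv y \<otimes> z = z \<otimes> (x \<otimes> y \<otimes> inv x \<otimes> inv y)"
    and k_pos: "1 \<le> k"
begin

section \<open>The centre and the commutator pairing\<close>

definition cen :: "'a set" where
  "cen = {z \<in> carrier G. \<forall>x\<in>carrier G. z \<otimes> x = x \<otimes> z}"

definition comm :: "'a \<Rightarrow> 'a \<Rightarrow> 'a" where
  "comm x y = x \<otimes> y \<otimes> inv x \<otimes> inv y"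

abbreviation Z where "Z \<equiv> G\<lparr>carrier := cen\<rparr>"

lemma subgroup_cen: "subgroup cen G"
proof (rule subgroupI)
  show "cen \<subseteq> carrier G" "cen \<noteq> {}" unfolding cen_def by auto
next
  fix a assume a: "a \<in> cen"
  show "inv a \<in> cen"
    unfolding cen_def
  proof (intro CollectI conjI ballI)
    show "inv a \<in> carrier G" using a unfolding cen_def by simp
    fix x assume x: "x \<in> carrier G"
    have ac: "a \<in> carrier G" and ax: "a \<otimes> inv x = inv x \<otimes> a" using a x unfolding cen_def by auto
    have "inv (a \<otimes> inv x) = inv (inv x \<otimes> a)" using ax by simp
    then show "inv a \<otimes> x = x \<otimes> inv a" using ac x by (simp add: inv_mult_group)
  qed
next
  fix a b assume a: "a \<in> cen" and b: "b \<in> cen"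
  show "a \<otimes> b \<in> cen"
    unfolding cen_def
  proof (intro CollectI conjI ballI)
    have ab: "a \<in> carrier G" "b \<in> carrier G" using a b unfolding cen_def by blast+
    then show "a \<otimes> b \<in> carrier G" by simp
    fix x assume x: "x \<in> carrier G"
    have "a \<otimes> x = x \<otimes> a" "b \<otimes> x = x \<otimes> b"
      using a b x unfolding cen_def by blast+
    then show "a \<otimes> b \<otimes> x = x \<otimes> (a \<otimes> b)" using ab x by (metis m_assoc)
  qed
qed

lemma cenD: "z \<in> cen \<Longrightarrow> z \<in> carrier G" "z \<in> cen \<Longrightarrow> x \<in> carrier G \<Longrightarrow> z \<otimes> x = x \<otimes> z"
  unfolding cen_def by auto

lemma comm_group_Z: "comm_group Z"
proof -
  interpret Zg: group Z by (rule subgroup.subgroup_is_group[OF subgroup_cen is_group])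
  show ?thesis
    by unfold_locales (auto intro: cenD)
qed

text \<open>\<open>finprod\<close> lives in commutative groups, so products of commutators are
  formed in the centre; the rewrites keep their multiplication and unit those of
  \<open>G\<close>.\<close>

sublocale Z: comm_group Z
  rewrites "carrier Z = cen" and "monoid.mult Z = monoid.mult G" and "monoid.one Z = monoid.one G"
  by (simp_all add: comm_group_Z)

lemma comm_cen [simp, intro]: "x \<in> carrier G \<Longrightarrow> y \<in> carrier G \<Longrightarrow> comm x y \<in> cen"
  unfolding cen_def comm_def using commutator_central by auto

lemma int_pow_Z: "z \<in> cen \<Longrightarrow> z [^]\<^bsub>Z\<^esub> (n::int) = z [^] n"
  using int_pow_consistent[OF subgroup_cen] by simp

lemma inv_Z: "z \<in> cen \<Longrightarrow> inv\<^bsub>Z\<^esub> z = inv z"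
  using m_inv_consistent[OF subgroup_cen] by simp

lemma comm_swap: "x \<in> carrier G \<Longrightarrow> y \<in> carrier G \<Longrightarrow> x \<otimes> y = comm x y \<otimes> (y \<otimes> x)"
  unfolding comm_def by (simp add: m_assoc) (simp add: m_assoc[symmetric])

text \<open>Commutator identities reduce to moving \<open>y\<close> past \<open>x\<close> and
  reading off the resulting factor; bilinearity is obtained this way.\<close>

lemma comm_unique:
  assumes "x \<in> carrier G" "y \<in> carrier G" "c \<in> carrier G" "x \<otimes> y = c \<otimes> (y \<otimes> x)"
  shows "comm x y = c"
  using comm_swap[OF assms(1,2)] assms by (metis cenD(1) comm_cen m_closed right_cancel)

lemma comm_mult_left:
  assumes x: "x \<in> carrier G" and y: "y \<in> carrier G" and z: "z \<in> carrier G"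
  shows "comm (x \<otimes> y) z = comm x z \<otimes> comm y z"
proof (rule comm_unique)
  note c = cenD(1)[OF comm_cen[OF x z]] cenD(1)[OF comm_cen[OF y z]]
  have "x \<otimes> y \<otimes> z = x \<otimes> (comm y z \<otimes> (z \<otimes> y))"
    using x y z comm_swap[OF y z] by (simp add: m_assoc)
  also have "\<dots> = (comm y z \<otimes> x) \<otimes> (z \<otimes> y)"
    using x y z c cenD(2)[OF comm_cen[OF y z] x] by (simp add: m_assoc)
  also have "\<dots> = comm y z \<otimes> (x \<otimes> z) \<otimes> y"
    using x y z c by (simp add: m_assoc)
  also have "\<dots> = comm y z \<otimes> (comm x z \<otimes> (z \<otimes> x)) \<otimes> y"
    using comm_swap[OF x z] by simp
  also have "\<dots> = (comm y z \<otimes> comm x z) \<otimes> (z \<otimes> (x \<otimes> y))"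
    using x y z c by (simp add: m_assoc)
  also have "comm y z \<otimes> comm x z = comm x z \<otimes> comm y z"
    using cenD(2)[OF comm_cen[OF y z] c(1)] .
  finally show "x \<otimes> y \<otimes> z = comm x z \<otimes> comm y z \<otimes> (z \<otimes> (x \<otimes> y))" .
qed (use assms in \<open>auto intro: cenD\<close>)

lemma comm_inverse:
  assumes x: "x \<in> carrier G" and y: "y \<in> carrier G"
  shows "comm y x = inv (comm x y)"
proof (rule comm_unique)
  show "y \<otimes> x = inv (comm x y) \<otimes> (x \<otimes> y)"
    using comm_swap[OF x y] x y by (metis comm_cen cenD(1) inv_closed inv_solve_left m_closed)
qed (use assms in \<open>auto intro: cenD\<close>)

lemma comm_mult_right:
  assumes x: "x \<in> carrier G" and y: "y \<in> carrier G" and z: "z \<in> carrier G"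
  shows "comm z (x \<otimes> y) = comm z x \<otimes> comm z y"
proof -
  note c = comm_cen[OF x z] comm_cen[OF y z]
  have "comm z (x \<otimes> y) = inv (comm x z \<otimes> comm y z)"
    using assms by (simp add: comm_inverse[of "x \<otimes> y"] comm_mult_left)
  also have "\<dots> = inv (comm y z) \<otimes> inv (comm x z)"
    using c cenD(1) by (simp add: inv_mult_group)
  also have "\<dots> = comm z y \<otimes> comm z x"
    by (simp only: comm_inverse[OF x z] comm_inverse[OF y z])
  also have "\<dots> = comm z x \<otimes> comm z y"
    using cenD(2)[OF comm_cen[OF z y]] cenD(1)[OF comm_cen[OF z x]] by simp
  finally show ?thesis .
qed

lemma comm_self [simp]: "x \<in> carrier G \<Longrightarrow> comm x x = \<one>"
  by (rule comm_unique) auto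

lemma comm_one [simp]: "x \<in> carrier G \<Longrightarrow> comm \<one> x = \<one>" "x \<in> carrier G \<Longrightarrow> comm x \<one> = \<one>"
  by (rule comm_unique; simp)+

lemma comm_inv_left:
  assumes x: "x \<in> carrier G" and z: "z \<in> carrier G"
  shows "comm (inv x) z = inv (comm x z)"
proof -
  have "comm (inv x) z \<otimes> comm x z = comm (inv x \<otimes> x) z"
    using assms by (intro comm_mult_left[symmetric]) auto
  also have "\<dots> = \<one>" using assms by simp
  finally show ?thesis
    using assms by (intro inv_equality[symmetric]) (auto intro: cenD)
qed

lemma comm_inv_right:
  assumes x: "x \<in> carrier G" and z: "z \<in> carrier G"
  shows "comm z (inv x) = inv (comm z x)"
  using assms by (metis comm_inv_left comm_inverse inv_closed)

lemma int_pow_card: "x \<in> carrier G \<Longrightarrow> int p ^ N dvd n \<Longrightarrow> x [^] (n::int) = \<one>"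
proof -
  assume x: "x \<in> carrier G" and "int p ^ N dvd n"
  then obtain t where t: "n = int (p ^ N) * t" by (auto elim: dvdE)
  have "x [^] (p ^ N) = \<one>"
    using pow_order_eq_1[OF x] card_carrier unfolding order_def by simp
  then have "x [^] int (p ^ N) = \<one>" by (simp only: int_pow_int)
  then show "x [^] n = \<one>" using x unfolding t by (simp flip: int_pow_pow)
qed

section \<open>Products of commutators with a matrix of exponents\<close>

abbreviation I where "I \<equiv> {1..k}"

text \<open>The product runs over all ordered pairs, so that a substitution acts exactly by
  \<open>A^T U A\<close> without any reordering. The redundancy in \<open>U\<close> is dealt with by
  \<open>Q_eqI\<close>.\<close>

definition Q :: "(nat \<Rightarrow> nat \<Rightarrow> int) \<Rightarrow> (nat \<Rightarrow> 'a) \<Rightarrow> 'a" where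
  "Q U g = finprod Z (\<lambda>(i, j). comm (g i) (g j) [^]\<^bsub>Z\<^esub> U i j) (I \<times> I)"

lemma assignmentsD: "g \<in> assignments G k \<Longrightarrow> i \<in> I \<Longrightarrow> g i \<in> carrier G"
  unfolding assignments_def by auto

lemma eval_word_Nil [simp]: "eval_word G g [] = \<one>"
  unfolding eval_word_def by simp

lemma eval_word_Cons:
  "eval_word G g ((i, b) # w) = (if b then inv (g i) else g i) \<otimes> eval_word G g w"
  unfolding eval_word_def by simp

lemma eval_word_closed:
  assumes "g \<in> assignments G k" "w \<in> words k"
  shows "eval_word G g w \<in> carrier G"
  using assms(2)
proof (induction w)
  case (Cons l w)
  then show ?case using assignmentsD[OF assms(1)] by (cases l) (auto simp: words_Cons eval_word_Cons)
qed simp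

lemma eval_word_append:
  assumes g: "g \<in> assignments G k" and "u \<in> words k" "v \<in> words k"
  shows "eval_word G g (u @ v) = eval_word G g u \<otimes> eval_word G g v"
  using assms(2)
proof (induction u)
  case Nil
  then show ?case using eval_word_closed[OF g assms(3)] by simp
next
  case (Cons l w)
  then show ?case
    using assignmentsD[OF g] eval_word_closed[OF g] assms(3)
    by (cases l) (auto simp: words_Cons eval_word_Cons m_assoc)
qed

lemma eval_word_inv_word:
  assumes g: "g \<in> assignments G k" and "w \<in> words k"
  shows "eval_word G g (inv_word w) = inv (eval_word G g w)"
  using assms(2)
proof (induction w)
  case Nil
  then show ?case by (simp add: inv_word_def)
next
  case (Cons l w)
  obtain i b where l: "l = (i, b)" by (cases l)
  have i: "i \<in> I" and w: "w \<in> words k" using Cons.prems l by (auto simp: words_Cons)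
  have "inv_word (l # w) = inv_word w @ [(i, \<not> b)]" unfolding inv_word_def l by simp
  moreover have "[(i, \<not> b)] \<in> words k" using i by (simp add: words_Cons words_Nil)
  ultimately have "eval_word G g (inv_word (l # w)) = inv (eval_word G g w) \<otimes> eval_word G g [(i, \<not> b)]"
    using Cons.IH[OF w] eval_word_append[OF g] w by (simp add: words_inv_word)
  then show ?case
    using assignmentsD[OF g i] eval_word_closed[OF g w] unfolding l
    by (simp add: eval_word_Cons inv_mult_group)
qed

definition sub :: "(nat \<Rightarrow> letter list) \<Rightarrow> (nat \<Rightarrow> 'a) \<Rightarrow> nat \<Rightarrow> 'a" where
  "sub u g = (\<lambda>i\<in>I. eval_word G g (u i))"

lemma sub_in_assignments:
  assumes "g \<in> assignments G k" "\<forall>i\<in>I. u i \<in> words k"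
  shows "sub u g \<in> assignments G k"
  using assms eval_word_closed unfolding sub_def assignments_def by auto

lemma eval_word_sub:
  assumes g: "g \<in> assignments G k" and u: "\<forall>i\<in>I. u i \<in> words k" and "w \<in> words k"
  shows "eval_word G (sub u g) w = eval_word G g (subst_word u w)"
  using assms(3)
proof (induction w)
  case Nil
  then show ?case by (simp add: subst_word_def)
next
  case (Cons l w)
  obtain i b where l: "l = (i, b)" by (cases l)
  have i: "i \<in> I" and w: "w \<in> words k" using Cons.prems l by (auto simp: words_Cons)
  have "sub u g i = eval_word G g (u i)" using i unfolding sub_def by simp
  then show ?case
    using Cons.IH[OF w] u[rule_format, OF i] subst_word_in_words[OF u w] unfolding l
    by (simp add: eval_word_Cons subst_word_Cons eval_word_append[OF g] eval_word_inv_word[OF g]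
        words_inv_word)
qed

lemma pairing_closed:
  assumes g: "g \<in> assignments G k"
  shows "(\<lambda>(i,j). comm (g i) (g j)) \<in> I \<times> I \<rightarrow> cen"
  using assignmentsD[OF g] by auto

lemma Q_closed [simp]:
  assumes "g \<in> assignments G k"
  shows "Q U g \<in> cen"
  unfolding Q_def by (rule Z.finprod_closed) (use assignmentsD[OF assms] in \<open>auto simp: Z.int_pow_closed\<close>)

lemma Q_alt: "Q U g = (\<Otimes>\<^bsub>Z\<^esub>x\<in>I \<times> I. (case x of (i,j) \<Rightarrow> comm (g i) (g j)) [^]\<^bsub>Z\<^esub> (case x of (i,j) \<Rightarrow> U i j))"
  unfolding Q_def by (simp add: case_prod_unfold)

lemma Q_add:
  assumes "g \<in> assignments G k"
  shows "Q (\<lambda>i j. U i j + V i j) g = Q U g \<otimes> Q V g"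
  using Z.finprod_pow_add[OF pairing_closed[OF assms], of "\<lambda>(i,j). U i j" "\<lambda>(i,j). V i j"]
  unfolding Q_alt by (simp add: case_prod_unfold)

lemma Q_cong:
  assumes "\<And>i j. i \<in> I \<Longrightarrow> j \<in> I \<Longrightarrow> U i j = V i j" and g: "g \<in> assignments G k"
  shows "Q U g = Q V g"
  unfolding Q_def
  by (rule Z.finprod_cong') (use assms(1) assignmentsD[OF g] in \<open>auto simp: Z.int_pow_closed\<close>)

lemma Q_zero [simp]: "g \<in> assignments G k \<Longrightarrow> Q (\<lambda>i j. 0) g = \<one>"
  unfolding Q_def by (rule Z.finprod_one_eqI) auto

lemma Q_single:
  assumes g: "g \<in> assignments G k" and ij: "i \<in> I" "j \<in> I"
    and "\<And>m n. m \<in> I \<Longrightarrow> n \<in> I \<Longrightarrow> (m, n) \<noteq> (i, j) \<Longrightarrow> U m n = 0"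
  shows "Q U g = comm (g i) (g j) [^] U i j"
proof -
  have "Q U g = (case (i, j) of (i, j) \<Rightarrow> comm (g i) (g j)) [^]\<^bsub>Z\<^esub> (case (i, j) of (i, j) \<Rightarrow> U i j)"
    unfolding Q_alt
    by (rule Z.finprod_pow_single[OF _ pairing_closed[OF g]]) (use ij assms(4) in auto)
  then show ?thesis using assignmentsD[OF g] ij by (simp add: int_pow_Z)
qed

lemma Q_pow:
  assumes g: "g \<in> assignments G k"
  shows "Q U g [^] (n::int) = Q (\<lambda>i j. n * U i j) g"
proof -
  have "Q U g [^] n = Q U g [^]\<^bsub>Z\<^esub> n" using Q_closed[OF g] by (simp add: int_pow_Z)
  also have "\<dots> = (\<Otimes>\<^bsub>Z\<^esub>x\<in>I \<times> I. ((\<lambda>(i,j). comm (g i) (g j) [^]\<^bsub>Z\<^esub> U i j) x) [^]\<^bsub>Z\<^esub> n)"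
    unfolding Q_def by (rule Z.finprod_int_pow) (use assignmentsD[OF g] in \<open>auto simp: Z.int_pow_closed\<close>)
  also have "\<dots> = Q (\<lambda>i j. n * U i j) g"
    unfolding Q_def
    by (rule Z.finprod_cong')
      (use assignmentsD[OF g] in \<open>auto simp: Z.int_pow_closed Z.int_pow_pow mult.commute\<close>)
  finally show ?thesis .
qed

text \<open>Under this hypothesis \<open>U - V\<close> is symmetric modulo \<open>p^N\<close>, and a
  symmetric exponent matrix contributes nothing.\<close>

lemma Q_eqI:
  assumes g: "g \<in> assignments G k"
    and UV: "\<And>i j. i \<in> I \<Longrightarrow> j \<in> I \<Longrightarrow> int p ^ N dvd (U i j - U j i) - (V i j - V j i)"
  shows "Q U g = Q V g"
proof -
  have "Q (\<lambda>i j. U i j - V i j) g = \<one>"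
    unfolding Q_def
  proof (rule Z.finprod_pow_symmetric[where M = "int p ^ N"])
    fix i j assume ij: "i \<in> I" "j \<in> I"
    then have c: "g i \<in> carrier G" "g j \<in> carrier G" using assignmentsD[OF g] by auto
    show "comm (g i) (g j) \<in> cen" using c by simp
    show "comm (g j) (g i) = inv\<^bsub>Z\<^esub> comm (g i) (g j)" using c by (simp add: comm_inverse[of "g i" "g j"] inv_Z)
    show "comm (g i) (g j) [^]\<^bsub>Z\<^esub> (int p ^ N) = \<one>"
      using c int_pow_card[of "comm (g i) (g j)" "int p ^ N"] by (simp add: int_pow_Z cenD)
    show "int p ^ N dvd U i j - V i j - (U j i - V j i)"
      using UV[OF ij] by (simp add: algebra_simps)
  qed (use assignmentsD[OF g] in auto)
  then have "Q V g = Q V g \<otimes> Q (\<lambda>i j. U i j - V i j) g"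
    using cenD(1)[OF Q_closed[OF g]] by simp
  also have "\<dots> = Q (\<lambda>i j. V i j + (U i j - V i j)) g"
    using Q_add[OF g, of V "\<lambda>i j. U i j - V i j"] by simp
  also have "\<dots> = Q U g" by simp
  finally show ?thesis by simp
qed

text \<open>Bilinearity breaks both words into letters, and the contributions of the letters add up
  to products of exponent sums.\<close>

lemma comm_eval_word:
  assumes g: "g \<in> assignments G k" and u: "u \<in> words k" and v: "v \<in> words k"
  shows "comm (eval_word G g u) (eval_word G g v) = Q (\<lambda>i j. exps u i * exps v j) g"
  using u
proof (induction u)
  case Nil
  show ?case using g eval_word_closed[OF g v] by simp
next
  case (Cons l u)
  obtain i b where l: "l = (i, b)" by (cases l)
  have i: "i \<in> I" and u: "u \<in> words k" using Cons.prems l by (auto simp: words_Cons)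
  define a where "a = (if b then inv (g i) else g i)"
  define \<epsilon> :: "nat \<Rightarrow> int" where "\<epsilon> m = (if m = i then if b then - 1 else 1 else 0)" for m
  have gi: "g i \<in> carrier G" using assignmentsD[OF g i] .
  then have a: "a \<in> carrier G" unfolding a_def by simp
  \<comment> \<open>With the first argument a single letter, the second one is expanded by its own
    induction.\<close>
  have "comm a (eval_word G g v) = Q (\<lambda>m n. \<epsilon> m * exps v n) g"
    using v
  proof (induction v)
    case Nil
    then show ?case using g a by simp
  next
    case (Cons l' v)
    obtain j b' where l': "l' = (j, b')" by (cases l')
    have j: "j \<in> I" and v: "v \<in> words k" using Cons.prems l' by (auto simp: words_Cons)
    define a' where "a' = (if b' then inv (g j) else g j)"
    have gj: "g j \<in> carrier G" using assignmentsD[OF g j] .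
    then have a': "a' \<in> carrier G" unfolding a'_def by simp
    let ?U = "\<lambda>m n. \<epsilon> m * (if n = j then if b' then - 1 else 1 else 0)"
    have "Q ?U g = comm (g i) (g j) [^] ?U i j"
      by (rule Q_single[OF g i j]) (auto simp: \<epsilon>_def)
    also have "\<dots> = comm a a'"
      using gi gj cenD(1)[OF comm_cen[OF gi gj]] unfolding a_def a'_def \<epsilon>_def
      by (auto simp: comm_inv_left comm_inv_right int_pow_neg)
    finally have single: "comm a a' = Q ?U g" by simp
    have "comm a (eval_word G g (l' # v)) = comm a a' \<otimes> comm a (eval_word G g v)"
      using a a' eval_word_closed[OF g v] unfolding l' eval_word_Cons a'_def[symmetric]
      by (simp add: comm_mult_right)
    also have "\<dots> = Q (\<lambda>m n. ?U m n + \<epsilon> m * exps v n) g"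
      unfolding single Cons.IH[OF v] using Q_add[OF g, of ?U] by simp
    finally show ?case unfolding l' by (simp add: distrib_left)
  qed
  then have "comm (eval_word G g (l # u)) (eval_word G g v)
     = Q (\<lambda>m n. \<epsilon> m * exps v n) g \<otimes> Q (\<lambda>i j. exps u i * exps v j) g"
    using Cons.IH[OF u] a eval_word_closed[OF g u] eval_word_closed[OF g v]
    unfolding l eval_word_Cons a_def[symmetric] by (simp add: comm_mult_left)
  also have "\<dots> = Q (\<lambda>m n. \<epsilon> m * exps v n + exps u m * exps v n) g"
    using Q_add[OF g, of "\<lambda>m n. \<epsilon> m * exps v n"] by simp
  finally show ?case unfolding l \<epsilon>_def by (simp add: distrib_right)
qed

text \<open>Each commutator of substituted words is a \<open>Q\<close> of rank one exponents;
  raising these to the powers \<open>U m n\<close> and multiplying adds the exponent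
  matrices.\<close>

lemma Q_sub:
  assumes g: "g \<in> assignments G k" and u: "\<forall>i\<in>I. u i \<in> words k"
  shows "Q U (sub u g) = Q (\<lambda>i j. \<Sum>m\<in>I. \<Sum>n\<in>I. exps (u m) i * U m n * exps (u n) j) g"
proof -
  let ?c = "\<lambda>(m, n) (i, j). exps (u m) i * exps (u n) j"
  let ?z = "\<lambda>(i,j). comm (g i) (g j)"
  have "Q U (sub u g) = (\<Otimes>\<^bsub>Z\<^esub>x\<in>I \<times> I. (\<Otimes>\<^bsub>Z\<^esub>y\<in>I \<times> I. ?z y [^]\<^bsub>Z\<^esub> ?c x y) [^]\<^bsub>Z\<^esub> (case x of (m,n) \<Rightarrow> U m n))"
    unfolding Q_alt[of U]
  proof (rule Z.finprod_cong')
    fix x assume "x \<in> I \<times> I"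
    then obtain m n where x: "x = (m, n)" and mn: "m \<in> I" "n \<in> I" by auto
    have "comm (sub u g m) (sub u g n) = Q (\<lambda>i j. exps (u m) i * exps (u n) j) g"
      using comm_eval_word[OF g u[rule_format, OF mn(1)] u[rule_format, OF mn(2)]] mn unfolding sub_def by simp
    then show "(case x of (i,j) \<Rightarrow> comm (sub u g i) (sub u g j)) [^]\<^bsub>Z\<^esub> (case x of (i,j) \<Rightarrow> U i j) =
       (\<Otimes>\<^bsub>Z\<^esub>y\<in>I \<times> I. ?z y [^]\<^bsub>Z\<^esub> ?c x y) [^]\<^bsub>Z\<^esub> (case x of (m,n) \<Rightarrow> U m n)"
      unfolding x Q_alt by (simp add: case_prod_unfold)
  next
    show "(\<lambda>x. (\<Otimes>\<^bsub>Z\<^esub>y\<in>I \<times> I. ?z y [^]\<^bsub>Z\<^esub> ?c x y) [^]\<^bsub>Z\<^esub> (case x of (m,n) \<Rightarrow> U m n)) \<in> I \<times> I \<rightarrow> cen"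
      using assignmentsD[OF g] by (auto intro!: Z.int_pow_closed Z.finprod_closed)
  qed simp
  also have "\<dots> = (\<Otimes>\<^bsub>Z\<^esub>y\<in>I \<times> I. ?z y [^]\<^bsub>Z\<^esub> (\<Sum>x\<in>I \<times> I. ?c x y * (case x of (m,n) \<Rightarrow> U m n)))"
    by (rule Z.finprod_pow_linear) (use pairing_closed[OF g] in auto)
  also have "\<dots> = Q (\<lambda>i j. \<Sum>m\<in>I. \<Sum>n\<in>I. exps (u m) i * U m n * exps (u n) j) g"
    unfolding Q_alt
    by (simp add: case_prod_unfold sum.cartesian_product ac_simps)
  finally show ?thesis .
qed

section \<open>Evaluation of words and collection of letters\<close>

lemma eval_gen: "g i \<in> carrier G \<Longrightarrow> eval_word G g (gen i) = g i"
  unfolding gen_def by (simp add: eval_word_Cons)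

lemma eval_gen_pow:
  assumes "g i \<in> carrier G"
  shows "eval_word G g (gen_pow i n) = g i [^] n"
proof -
  have rep: "eval_word G g (replicate m (i, b)) = (if b then inv (g i) else g i) [^] m" for m b
  proof (induction m)
    case (Suc m)
    let ?x = "if b then inv (g i) else g i"
    have "?x \<in> carrier G" using assms by simp
    then show ?case using nat_pow_Suc2[of ?x m] Suc by (simp add: eval_word_Cons)
  qed simp
  show ?thesis
  proof (cases "n < 0")
    case True
    then obtain m where n: "n = - int m" by (metis int_cases2 neg_0_le_iff_le not_le of_nat_0_le_iff)
    then show ?thesis
      using True assms unfolding gen_pow_def rep by (simp add: int_pow_neg_int nat_pow_inv)
  next
    case False
    then obtain m where n: "n = int m" by (metis nonneg_int_cases not_less)
    then show ?thesis
      using assms unfolding gen_pow_def rep by (simp add: int_pow_int)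
  qed
qed

lemma eval_word_cong:
  "(\<And>j b. (j, b) \<in> set w \<Longrightarrow> g j = g' j) \<Longrightarrow> eval_word G g w = eval_word G g' w"
proof (induction w)
  case (Cons l w)
  obtain i b where l: "l = (i, b)" by (cases l)
  have "g i = g' i" using Cons.prems[of i b] unfolding l by simp
  moreover have "eval_word G g w = eval_word G g' w" using Cons by (metis list.set_intros(2))
  ultimately show ?case unfolding l by (simp add: eval_word_Cons)
qed simp

lemma eval_comm_word:
  assumes g: "g \<in> assignments G k" and u: "u \<in> words k" and v: "v \<in> words k"
  shows "eval_word G g (comm_word u v) = comm (eval_word G g u) (eval_word G g v)"
  using assms eval_word_closed[OF g]
  by (simp add: comm_word_def comm_def eval_word_append eval_word_inv_word words_append
      words_inv_word m_assoc)

lemma comm_word_in_words: "u \<in> words k \<Longrightarrow> v \<in> words k \<Longrightarrow> comm_word u v \<in> words k"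
  unfolding comm_word_def by (simp add: words_append words_inv_word)

lemma eval_word_pow:
  assumes g: "g \<in> assignments G k" and w: "w \<in> words k"
  shows "eval_word G g (word_pow w m) = eval_word G g w [^] m" and "word_pow w m \<in> words k"
proof -
  show wp: "word_pow w m \<in> words k" for m
    using w unfolding word_pow_def by (auto simp: words_concat)
  show "eval_word G g (word_pow w m) = eval_word G g w [^] m"
  proof (induction m)
    case 0
    show ?case by (simp add: word_pow_def)
  next
    case (Suc m)
    have "word_pow w (Suc m) = w @ word_pow w m" by (simp add: word_pow_def)
    then show ?case
      using Suc eval_word_append[OF g w wp] nat_pow_Suc2[OF eval_word_closed[OF g w]] by simp
  qed
qed

text \<open>One round of Hall's collecting process: the letter travels right to its own power. The
  commutator created on the way is central and is absorbed into \<open>Q\<close>, so collection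
  stops after this single layer.\<close>

lemma collect_letter:
  assumes "n \<le> k" "i \<in> {1..n}"
  shows "\<exists>U. \<forall>g \<in> assignments G k.
    eval_word G g [(i, b)] \<otimes> eval_word G g (monomial_word a n)
    = eval_word G g (monomial_word (a(i := (if b then - 1 else 1) + a i)) n) \<otimes> Q U g"
  using assms
proof (induction n)
  case (Suc n)
  let ?a = "a(i := (if b then - 1 else 1) + a i)"
  have lw: "[(i, b)] \<in> words k" using Suc.prems by (auto simp: words_Cons words_Nil)
  have mw: "monomial_word c n \<in> words k" "gen_pow (Suc n) m \<in> words k" for c m
    using Suc.prems monomial_word_in_words gen_pow_in_words by auto
  show ?case
  proof (cases "i = Suc n")
    case False
    then obtain U where U: "\<And>g. g \<in> assignments G k \<Longrightarrow>
      eval_word G g [(i, b)] \<otimes> eval_word G g (monomial_word a n)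
      = eval_word G g (monomial_word ?a n) \<otimes> Q U g"
      using Suc by fastforce
    have "eval_word G g [(i, b)] \<otimes> eval_word G g (monomial_word a (Suc n))
      = eval_word G g (monomial_word ?a (Suc n)) \<otimes> Q U g" if g: "g \<in> assignments G k" for g
    proof -
      let ?X = "eval_word G g (gen_pow (Suc n) (a (Suc n)))"
      let ?M = "eval_word G g (monomial_word ?a n)"
      note cl = eval_word_closed[OF g lw] eval_word_closed[OF g mw(1)] eval_word_closed[OF g mw(2)]
      have q: "Q U g \<in> carrier G" "Q U g \<otimes> ?X = ?X \<otimes> Q U g"
        using cenD[OF Q_closed[OF g]] cl(3) by auto
      have "eval_word G g [(i, b)] \<otimes> eval_word G g (monomial_word a (Suc n))
        = (eval_word G g [(i, b)] \<otimes> eval_word G g (monomial_word a n)) \<otimes> ?X"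
        unfolding monomial_word_Suc eval_word_append[OF g mw] using cl by (simp add: m_assoc)
      also have "\<dots> = ?M \<otimes> (Q U g \<otimes> ?X)"
        unfolding U[OF g] using cl q by (simp add: m_assoc)
      also have "\<dots> = eval_word G g (monomial_word ?a (Suc n)) \<otimes> Q U g"
        unfolding q(2) monomial_word_Suc eval_word_append[OF g mw] using cl q False
        by (simp add: m_assoc)
      finally show ?thesis .
    qed
    then show ?thesis by blast
  next
    case True
    let ?U = "\<lambda>m j. exps [(i, b)] m * exps (monomial_word a n) j"
    have same: "monomial_word ?a n = monomial_word a n"
      by (rule monomial_word_cong) (use True in auto)
    have "eval_word G g [(i, b)] \<otimes> eval_word G g (monomial_word a (Suc n))
      = eval_word G g (monomial_word ?a (Suc n)) \<otimes> Q ?U g" if g: "g \<in> assignments G k" for g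
    proof -
      let ?l = "eval_word G g [(i, b)]" and ?M = "eval_word G g (monomial_word a n)"
      let ?X = "eval_word G g (gen_pow (Suc n) (a (Suc n)))"
      have gi: "g i \<in> carrier G" using assignmentsD[OF g] Suc.prems by auto
      note cl = eval_word_closed[OF g lw] eval_word_closed[OF g mw(1)] eval_word_closed[OF g mw(2)]
      have "?l = g i [^] (if b then - 1 else 1 :: int)"
        using gi by (simp add: eval_word_Cons int_pow_neg)
      then have "?l \<otimes> ?X = g i [^] ((if b then - 1 else 1) + a i)"
        using gi True eval_gen_pow[of g i] by (simp only: int_pow_mult)
      then have lX: "?l \<otimes> ?X = eval_word G g (gen_pow (Suc n) (?a (Suc n)))"
        using gi True eval_gen_pow[of g i] by simp
      have c: "comm ?l ?M = Q ?U g" using comm_eval_word[OF g lw mw(1)] .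
      have "?l \<otimes> eval_word G g (monomial_word a (Suc n)) = (?l \<otimes> ?M) \<otimes> ?X"
        unfolding monomial_word_Suc eval_word_append[OF g mw] using cl by (simp add: m_assoc)
      also have "?l \<otimes> ?M = Q ?U g \<otimes> (?M \<otimes> ?l)"
        using comm_swap[OF cl(1) cl(2)[of a]] unfolding c .
      also have "Q ?U g \<otimes> (?M \<otimes> ?l) \<otimes> ?X = Q ?U g \<otimes> (?M \<otimes> (?l \<otimes> ?X))"
        using cl cenD(1)[OF Q_closed[OF g]] by (simp only: m_assoc m_closed)
      also have "\<dots> = Q ?U g \<otimes> eval_word G g (monomial_word ?a (Suc n))"
        unfolding lX monomial_word_Suc eval_word_append[OF g mw] same ..
      also have "\<dots> = eval_word G g (monomial_word ?a (Suc n)) \<otimes> Q ?U g"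
        by (rule cenD(2)[OF Q_closed[OF g] eval_word_closed[OF g monomial_word_in_words[OF Suc.prems(1)]]])
      finally show ?thesis .
    qed
    then show ?thesis by blast
  qed
qed simp

lemma collect_word:
  assumes "w \<in> words k"
  shows "\<exists>U. \<forall>g \<in> assignments G k. eval_word G g w = eval_word G g (monomial_word (exps w) k) \<otimes> Q U g"
  using assms
proof (induction w)
  case Nil
  have "exps [] = (\<lambda>_. 0)" by (intro ext) simp
  then have e: "monomial_word (exps []) k = []" unfolding monomial_word_def gen_pow_def by simp
  show ?case unfolding e by (rule exI[of _ "\<lambda>i j. 0"]) simp
next
  case (Cons l w)
  obtain i b where l: "l = (i, b)" by (cases l)
  have i: "i \<in> {1..k}" and w: "w \<in> words k" using Cons.prems l by (auto simp: words_Cons)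
  obtain U where U: "\<And>g. g \<in> assignments G k \<Longrightarrow>
      eval_word G g w = eval_word G g (monomial_word (exps w) k) \<otimes> Q U g"
    using Cons.IH[OF w] by blast
  let ?a = "(exps w)(i := (if b then - 1 else 1) + exps w i)"
  obtain V where V: "\<And>g. g \<in> assignments G k \<Longrightarrow>
      eval_word G g [(i, b)] \<otimes> eval_word G g (monomial_word (exps w) k)
      = eval_word G g (monomial_word ?a k) \<otimes> Q V g"
    using collect_letter[OF order_refl i] by blast
  have a: "exps (l # w) = ?a" unfolding l by (intro ext) simp
  have "eval_word G g (l # w) = eval_word G g (monomial_word (exps (l # w)) k) \<otimes> Q (\<lambda>i j. V i j + U i j) g"
    if g: "g \<in> assignments G k" for g
  proof -
    have lw: "[l] \<in> words k" using i unfolding l by (simp add: words_Cons words_Nil)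
    have cl: "eval_word G g [l] \<in> carrier G" "\<And>a. eval_word G g (monomial_word a k) \<in> carrier G"
      "\<And>U. Q U g \<in> carrier G"
      using eval_word_closed[OF g] lw monomial_word_in_words[OF order_refl] cenD(1)[OF Q_closed[OF g]]
      by auto
    have "eval_word G g (l # w) = eval_word G g [l] \<otimes> eval_word G g w"
      using eval_word_append[OF g lw w] by simp
    also have "\<dots> = (eval_word G g [l] \<otimes> eval_word G g (monomial_word (exps w) k)) \<otimes> Q U g"
      unfolding U[OF g] using cl by (simp add: m_assoc)
    also have "\<dots> = eval_word G g (monomial_word ?a k) \<otimes> (Q V g \<otimes> Q U g)"
      unfolding l V[OF g] using cl by (simp add: m_assoc)
    finally show ?thesis unfolding a Q_add[OF g] .
  qed
  then show ?case by blast
qed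

text \<open>After collection, the power of each generator depends on its exponent modulo
  \<open>p^N\<close> only, so at most a power of \<open>x_1\<close> remains in front.\<close>

lemma eval_word_normal:
  assumes w: "w \<in> words k"
    and t: "\<And>j. j \<in> I \<Longrightarrow> int p ^ N dvd exps w j - (if j = 1 then t else 0)"
  shows "\<exists>U. \<forall>g \<in> assignments G k. eval_word G g w = g 1 [^] t \<otimes> Q U g"
proof -
  have "eval_word G g (monomial_word (exps w) n) = (if n = 0 then \<one> else g 1 [^] t)"
    if g: "g \<in> assignments G k" and "n \<le> k" for g n
    using that(2)
  proof (induction n)
    case 0
    show ?case by (simp add: monomial_word_0)
  next
    case (Suc n)
    have gn: "g (Suc n) \<in> carrier G" "g 1 \<in> carrier G" using assignmentsD[OF g] Suc.prems k_pos by auto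
    have "eval_word G g (monomial_word (exps w) (Suc n))
      = (if n = 0 then \<one> else g 1 [^] t) \<otimes> g (Suc n) [^] exps w (Suc n)"
      unfolding monomial_word_Suc using Suc gn
      by (subst eval_word_append[OF g]) (auto simp: monomial_word_in_words gen_pow_in_words eval_gen_pow)
    moreover have "g (Suc n) [^] exps w (Suc n) = g (Suc n) [^] (if Suc n = 1 then t else 0)"
    proof -
      have "g (Suc n) [^] (exps w (Suc n) - (if Suc n = 1 then t else 0)) = \<one>"
        using int_pow_card[OF gn(1)] t[of "Suc n"] Suc.prems by simp
      then have "g (Suc n) [^] ((exps w (Suc n) - (if Suc n = 1 then t else 0)) + (if Suc n = 1 then t else 0))
         = g (Suc n) [^] (if Suc n = 1 then t else 0)"
        using gn(1) by (subst int_pow_mult) auto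
      then show ?thesis by simp
    qed
    ultimately show ?case using gn by auto
  qed
  then have "eval_word G g (monomial_word (exps w) k) = g 1 [^] t" if "g \<in> assignments G k" for g
    using that k_pos by simp
  then show ?thesis using collect_word[OF w] by simp
qed

section \<open>Substitutions that permute \<open>G^k\<close>\<close>

text \<open>Stated for functions on \<open>G^k\<close> rather than words, so that intermediate
  normal forms need not be written as words. Injectivity of \<open>sub u\<close> already makes it a
  permutation of the finite set of assignments.\<close>

definition auto_equiv :: "((nat \<Rightarrow> 'a) \<Rightarrow> 'a) \<Rightarrow> ((nat \<Rightarrow> 'a) \<Rightarrow> 'a) \<Rightarrow> bool" where
  "auto_equiv f f' \<longleftrightarrow> (\<exists>u. (\<forall>i\<in>I. u i \<in> words k) \<and> inj_on (sub u) (assignments G k)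
     \<and> (\<forall>g\<in>assignments G k. f' g = f (sub u g)))"

lemma finite_assignments: "finite (assignments G k)"
  unfolding assignments_def using finite_carrier by (simp add: finite_PiE)

lemma assignments_eqI:
  assumes "g \<in> assignments G k" "g' \<in> assignments G k" "\<And>i. i \<in> I \<Longrightarrow> g i = g' i"
  shows "g = g'"
  using assms unfolding assignments_def by (auto intro: PiE_ext)

lemma sub_gen:
  assumes "g \<in> assignments G k"
  shows "sub gen g = g"
proof (rule assignments_eqI)
  show "sub gen g \<in> assignments G k"
    by (rule sub_in_assignments[OF assms]) (simp add: gen_in_words)
  show "sub gen g i = g i" if "i \<in> I" for i
    using that assignmentsD[OF assms] unfolding sub_def by (simp add: eval_gen)
qed (rule assms)

lemma auto_equiv_refl:
  assumes "\<forall>g\<in>assignments G k. f g = f' g"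
  shows "auto_equiv f f'"
  unfolding auto_equiv_def
  by (rule exI[of _ gen]) (use assms in \<open>auto simp: sub_gen gen_in_words inj_on_def\<close>)

lemma auto_equiv_trans:
  assumes "auto_equiv f1 f2" "auto_equiv f2 f3"
  shows "auto_equiv f1 f3"
proof -
  obtain u where u: "\<forall>i\<in>I. u i \<in> words k" and inju: "inj_on (sub u) (assignments G k)"
    and fu: "\<And>g. g \<in> assignments G k \<Longrightarrow> f2 g = f1 (sub u g)"
    using assms(1) unfolding auto_equiv_def by blast
  obtain v where v: "\<forall>i\<in>I. v i \<in> words k" and injv: "inj_on (sub v) (assignments G k)"
    and fv: "\<And>g. g \<in> assignments G k \<Longrightarrow> f3 g = f2 (sub v g)"
    using assms(2) unfolding auto_equiv_def by blast
  have comp: "sub (\<lambda>i. subst_word v (u i)) g = sub u (sub v g)" if g: "g \<in> assignments G k" for g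
    unfolding sub_def[of u] sub_def[of "\<lambda>i. subst_word v (u i)"]
    by (rule restrict_ext) (use eval_word_sub[OF g v] u in simp)
  have vg: "sub v g \<in> assignments G k" if "g \<in> assignments G k" for g
    using sub_in_assignments[OF that v] .
  have "inj_on (sub (\<lambda>i. subst_word v (u i))) (assignments G k)"
    unfolding inj_on_def using comp inju injv vg by (metis inj_on_def)
  moreover have "\<forall>g\<in>assignments G k. f3 g = f1 (sub (\<lambda>i. subst_word v (u i)) g)"
    using comp fu fv vg by simp
  moreover have "\<forall>i\<in>I. subst_word v (u i) \<in> words k"
    using subst_word_in_words[OF v] u by blast
  ultimately show ?thesis
    unfolding auto_equiv_def by (intro exI[of _ "\<lambda>i. subst_word v (u i)"] conjI)
qed

lemma sub_surj:
  assumes "\<forall>i\<in>I. u i \<in> words k" "inj_on (sub u) (assignments G k)"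
  shows "sub u ` assignments G k = assignments G k"
  by (rule endo_inj_surj[OF finite_assignments _ assms(2)]) (use sub_in_assignments assms(1) in blast)

text \<open>Composition with \<open>sub u\<close> is multiplicative and maps word maps to word maps.
  It is injective because \<open>sub u\<close> is onto, hence bijective on the finite group of word
  maps; in this way the inverse permutation never has to be given by words.\<close>

lemma auto_equiv_automorphic:
  assumes "auto_equiv (\<lambda>g. eval_word G g w) (\<lambda>g. eval_word G g v)" and w: "w \<in> words k"
  shows "automorphic G k w v"
proof -
  obtain u where u: "\<forall>i\<in>I. u i \<in> words k" and inju: "inj_on (sub u) (assignments G k)"
    and uv: "\<And>g. g \<in> assignments G k \<Longrightarrow> eval_word G g v = eval_word G (sub u g) w"
    using assms(1) unfolding auto_equiv_def by blast
  note surj = sub_surj[OF u inju]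
  have ug: "sub u g \<in> assignments G k" if "g \<in> assignments G k" for g
    using sub_in_assignments[OF that u] .
  let ?F = "word_map_group G k"
  define \<phi> where "\<phi> f = (\<lambda>g\<in>assignments G k. f (sub u g))" for f :: "(nat \<Rightarrow> 'a) \<Rightarrow> 'a"
  have carF: "carrier ?F = word_map G k ` words k" unfolding word_map_group_def by simp
  have \<phi>w: "\<phi> (word_map G k x) = word_map G k (subst_word u x)" if "x \<in> words k" for x
    unfolding \<phi>_def word_map_def
    by (rule restrict_ext) (use ug eval_word_sub[OF _ u that] in auto)
  have closed: "\<phi> f \<in> carrier ?F" if "f \<in> carrier ?F" for f
    using that \<phi>w subst_word_in_words[OF u] unfolding carF by blast
  have ext: "f \<in> assignments G k \<rightarrow>\<^sub>E carrier G" if "f \<in> carrier ?F" for f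
    using that eval_word_closed unfolding carF word_map_def by auto
  have "finite (assignments G k \<rightarrow>\<^sub>E carrier G)"
    using finite_assignments finite_carrier by (simp add: finite_PiE)
  then have fin: "finite (carrier ?F)" by (rule finite_subset[rotated]) (use ext in blast)
  have "inj_on \<phi> (carrier ?F)"
  proof (rule inj_onI)
    fix f f' assume f: "f \<in> carrier ?F" "f' \<in> carrier ?F" and eq: "\<phi> f = \<phi> f'"
    show "f = f'"
    proof (rule PiE_ext[OF ext[OF f(1)] ext[OF f(2)]])
      fix g assume "g \<in> assignments G k"
      then obtain g' where g': "g' \<in> assignments G k" "g = sub u g'" using surj by blast
      have "\<phi> f g' = \<phi> f' g'" using eq by simp
      then show "f g = f' g" using g' unfolding \<phi>_def by simp
    qed
  qed
  moreover from this have "\<phi> ` carrier ?F = carrier ?F"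
    by (rule endo_inj_surj[OF fin, rotated]) (use closed in blast)
  ultimately have "bij_betw \<phi> (carrier ?F) (carrier ?F)" unfolding bij_betw_def by simp
  moreover have "\<phi> \<in> hom ?F ?F"
  proof (rule homI)
    show "\<phi> f \<in> carrier ?F" if "f \<in> carrier ?F" for f using closed[OF that] .
    show "\<phi> (f \<otimes>\<^bsub>?F\<^esub> f') = \<phi> f \<otimes>\<^bsub>?F\<^esub> \<phi> f'" for f f'
      unfolding \<phi>_def word_map_group_def using ug by (auto intro!: restrict_ext)
  qed
  ultimately have "\<phi> \<in> iso ?F ?F" unfolding iso_def by simp
  moreover have "\<phi> (word_map G k w) = word_map G k v"
    unfolding \<phi>_def word_map_def by (rule restrict_ext) (use ug uv in simp)
  ultimately show ?thesis unfolding automorphic_def by blast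
qed

lemma auto_equiv_card:
  assumes "auto_equiv f f'"
  shows "card {g \<in> assignments G k. f' g = x} = card {g \<in> assignments G k. f g = x}"
proof -
  obtain u where u: "\<forall>i\<in>I. u i \<in> words k" and inju: "inj_on (sub u) (assignments G k)"
    and fu: "\<And>g. g \<in> assignments G k \<Longrightarrow> f' g = f (sub u g)"
    using assms unfolding auto_equiv_def by blast
  have "sub u ` {g \<in> assignments G k. f' g = x} = {g \<in> assignments G k. f g = x}"
    using sub_surj[OF u inju] sub_in_assignments[OF _ u] fu by (auto simp: image_iff) (metis imageE)
  moreover have "inj_on (sub u) {g \<in> assignments G k. f' g = x}"
    by (rule inj_on_subset[OF inju]) auto
  ultimately show ?thesis using card_image[of "sub u" "{g \<in> assignments G k. f' g = x}"] by simp
qed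

section \<open>Normal forms and the moves acting on them\<close>

text \<open>An exponent matrix \<open>U\<close> with \<open>U - U^T = B\<close>. Using
  \<open>B\<close> itself would double every exponent, and this cannot be undone for
  \<open>p = 2\<close>.\<close>

definition upper :: "(nat \<Rightarrow> nat \<Rightarrow> int) \<Rightarrow> nat \<Rightarrow> nat \<Rightarrow> int" where
  "upper B i j = (if i < j then B i j else 0)"

definition form_map :: "int \<Rightarrow> (nat \<Rightarrow> nat \<Rightarrow> int) \<Rightarrow> (nat \<Rightarrow> 'a) \<Rightarrow> 'a" where
  "form_map t B g = g 1 [^] t \<otimes> Q (upper B) g"

lemma upper_skew:
  assumes "alternating_on K B"
  shows "upper B i j - upper B j i = B i j"
  using alternating_onD(1)[OF assms, of i j] alternating_onD(2)[OF assms, of i]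
  unfolding upper_def by (cases i j rule: linorder_cases) auto

lemma Q_central:
  assumes g: "g \<in> assignments G k" and z: "\<And>i. i \<in> I \<Longrightarrow> z i \<in> cen"
    and h: "\<And>i. i \<in> I \<Longrightarrow> h i = g i \<otimes> z i"
  shows "Q U h = Q U g"
proof -
  have zc: "comm (z i) x = \<one>" "comm x (z i) = \<one>" if "i \<in> I" "x \<in> carrier G" for i x
    using that cenD[OF z[OF that(1)]] by (auto intro!: comm_unique)
  have "comm (h i) (h j) = comm (g i) (g j)" if "i \<in> I" "j \<in> I" for i j
    using that h zc cenD(1)[OF z] assignmentsD[OF g] cenD(1)[OF comm_cen]
    by (simp add: comm_mult_left comm_mult_right)
  then show ?thesis
    unfolding Q_def by (intro Z.finprod_cong') (use assignmentsD[OF g] in \<open>auto simp: Z.int_pow_closed\<close>)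
qed

text \<open>Central twists must be substitutions by words, so each \<open>Q U\<close> has to be the
  value of a word. The word is built by adding one commutator \<open>[x_a^(U a b), x_b]\<close> for
  each index pair.\<close>

lemma ex_word_Q: "\<exists>q \<in> words k. \<forall>g \<in> assignments G k. eval_word G g q = Q U g"
proof -
  have "\<exists>q \<in> words k. \<forall>g \<in> assignments G k. eval_word G g q = Q (\<lambda>i j. if (i, j) \<in> S then U i j else 0) g"
    if "finite S" "S \<subseteq> I \<times> I" for S
    using that
  proof (induction S)
    case empty
    show ?case by (rule bexI[of _ "[]"]) (auto simp: words_Nil)
  next
    case (insert x S)
    obtain a b where x: "x = (a, b)" by (cases x)
    have ab: "a \<in> I" "b \<in> I" and S: "S \<subseteq> I \<times> I" using insert.prems x by auto
    obtain q where q: "q \<in> words k"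
      "\<And>g. g \<in> assignments G k \<Longrightarrow> eval_word G g q = Q (\<lambda>i j. if (i, j) \<in> S then U i j else 0) g"
      using insert.IH[OF S] by blast
    let ?u = "gen_pow a (U a b)" and ?v = "gen b"
    have uv: "?u \<in> words k" "?v \<in> words k" using ab gen_pow_in_words gen_in_words by auto
    have "eval_word G g (comm_word ?u ?v @ q) = Q (\<lambda>i j. if (i, j) \<in> insert x S then U i j else 0) g"
      if g: "g \<in> assignments G k" for g
    proof -
      have "eval_word G g (comm_word ?u ?v @ q)
        = Q (\<lambda>i j. exps ?u i * exps ?v j + (if (i, j) \<in> S then U i j else 0)) g"
        using eval_word_append[OF g comm_word_in_words[OF uv] q(1)] q(2)[OF g]
          eval_comm_word[OF g uv] comm_eval_word[OF g uv] Q_add[OF g, of "\<lambda>i j. exps ?u i * exps ?v j"]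
        by simp
      also have "(\<lambda>i j. exps ?u i * exps ?v j + (if (i, j) \<in> S then U i j else 0))
        = (\<lambda>i j. if (i, j) \<in> insert x S then U i j else 0)"
        using insert.hyps(2) unfolding x by (intro ext) (auto simp: exps_gen_pow exps_gen)
      finally show ?thesis .
    qed
    moreover have "comm_word ?u ?v @ q \<in> words k" using uv q by (simp add: words_append comm_word_in_words)
    ultimately show ?case by blast
  qed
  from this[of "I \<times> I"] obtain q where q: "q \<in> words k"
    "\<And>g. g \<in> assignments G k \<Longrightarrow> eval_word G g q = Q (\<lambda>i j. if (i, j) \<in> I \<times> I then U i j else 0) g"
    by auto
  have "Q (\<lambda>i j. if (i, j) \<in> I \<times> I then U i j else 0) g = Q U g" if "g \<in> assignments G k" for g
    by (rule Q_cong) (use that in auto)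
  then show ?thesis using q by auto
qed

text \<open>Injectivity holds because two assignments with the same image differ by central elements
  only, so they have the same value of \<open>Q U\<close>, and this common factor can be
  cancelled.\<close>

lemma ex_central_twist:
  obtains u where "\<forall>i\<in>I. u i \<in> words k" "inj_on (sub u) (assignments G k)"
    "\<forall>g\<in>assignments G k. \<forall>i\<in>I. sub u g i = g i \<otimes> (if i = 1 then Q U g else \<one>)"
proof -
  obtain q where q: "q \<in> words k" "\<And>g. g \<in> assignments G k \<Longrightarrow> eval_word G g q = Q U g"
    using ex_word_Q by blast
  define u where "u i = (if i = 1 then gen 1 @ q else gen i)" for i
  have u: "\<forall>i\<in>I. u i \<in> words k"
    using q(1) k_pos unfolding u_def by (auto simp: words_append gen_in_words)
  have val: "sub u g i = g i \<otimes> (if i = 1 then Q U g else \<one>)" if g: "g \<in> assignments G k" and i: "i \<in> I" for g i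
    using i assignmentsD[OF g] q k_pos g unfolding sub_def u_def
    by (auto simp: eval_word_append[OF g] gen_in_words eval_gen)
  have "inj_on (sub u) (assignments G k)"
  proof (rule inj_onI)
    fix g g' assume g: "g \<in> assignments G k" and g': "g' \<in> assignments G k" and eq: "sub u g = sub u g'"
    have eqi: "g i \<otimes> (if i = 1 then Q U g else \<one>) = g' i \<otimes> (if i = 1 then Q U g' else \<one>)" if "i \<in> I" for i
      using val[OF g that] val[OF g' that] eq by simp
    have one: "1 \<in> I" using k_pos by simp
    note c = Q_closed[OF g, of U] Q_closed[OF g', of U]
    \<comment> \<open>The central discrepancy between \<open>g\<close> and \<open>g'\<close>, as
      forced by equality of the images.\<close>
    define z where "z i = (if i = (1::nat) then Q U g' \<otimes> inv (Q U g) else \<one>)" for i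
    have zc: "z i \<in> cen" for i
      unfolding z_def using c subgroup.m_closed[OF subgroup_cen] subgroup.m_inv_closed[OF subgroup_cen]
        subgroup.one_closed[OF subgroup_cen] by simp
    have "g i = g' i \<otimes> z i" if "i \<in> I" for i
    proof (cases "i = 1")
      case True
      have "g 1 \<otimes> Q U g = g' 1 \<otimes> Q U g'" using eqi[OF one] by simp
      then have "g 1 = g' 1 \<otimes> Q U g' \<otimes> inv (Q U g)"
        using assignmentsD[OF g one] assignmentsD[OF g' one] cenD(1)[OF c(1)] cenD(1)[OF c(2)]
        by (metis inv_solve_right m_closed)
      then show ?thesis
        using True assignmentsD[OF g' one] cenD(1)[OF c(1)] cenD(1)[OF c(2)] unfolding z_def
        by (simp add: m_assoc)
    next
      case False
      then show ?thesis
        using eqi[OF that] assignmentsD[OF g that] assignmentsD[OF g' that] unfolding z_def by simp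
    qed
    then have "Q U g = Q U g'" using Q_central[OF g' zc] by simp
    then have "g i = g' i" if "i \<in> I" for i
      using eqi[OF that] assignmentsD[OF g that] assignmentsD[OF g' that] cenD(1)[OF c(1)]
      by (cases "i = 1") auto
    then show "g = g'" by (rule assignments_eqI[OF g g'])
  qed
  then show ?thesis using that[of u] u val by blast
qed

text \<open>The assumption \<open>one\<close> protects the factor \<open>g 1 [^] t\<close>. For the
  commutator part, only the alternating part of \<open>A^T U A\<close> with
  \<open>U = upper B\<close> counts, and this is \<open>A^T B A\<close>.\<close>

lemma auto_equiv_form_map:
  assumes u: "\<forall>i\<in>I. u i \<in> words k" and inj: "inj_on (sub u) (assignments G k)"
    and one: "t = 0 \<or> u 1 = gen 1" and alt: "alternating_on k B" and alt': "alternating_on k B'"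
    and B': "\<And>i j. i \<in> I \<Longrightarrow> j \<in> I \<Longrightarrow> (\<Sum>m\<in>I. \<Sum>n\<in>I. exps (u m) i * B m n * exps (u n) j) = B' i j"
  shows "auto_equiv (form_map t B) (form_map t B')"
  unfolding auto_equiv_def
proof (intro exI[of _ u] conjI ballI)
  fix g assume g: "g \<in> assignments G k"
  let ?V = "\<lambda>i j. \<Sum>m\<in>I. \<Sum>n\<in>I. exps (u m) i * upper B m n * exps (u n) j"
  have skew: "?V i j - ?V j i = B' i j" if "i \<in> I" "j \<in> I" for i j
  proof -
    have "?V j i = (\<Sum>m\<in>I. \<Sum>n\<in>I. exps (u m) i * upper B n m * exps (u n) j)"
      by (subst sum.swap) (simp add: ac_simps)
    then have "?V i j - ?V j i = (\<Sum>m\<in>I. \<Sum>n\<in>I. exps (u m) i * (upper B m n - upper B n m) * exps (u n) j)"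
      by (simp add: sum_subtractf algebra_simps)
    then show ?thesis unfolding upper_skew[OF alt] B'[OF that] .
  qed
  have "Q (upper B) (sub u g) = Q ?V g" by (rule Q_sub[OF g u])
  also have "\<dots> = Q (upper B') g"
    by (rule Q_eqI[OF g]) (simp only: skew upper_skew[OF alt'], simp)
  finally have "Q (upper B) (sub u g) = Q (upper B') g" .
  moreover have "sub u g 1 [^] t = g 1 [^] t"
    using one k_pos assignmentsD[OF g] unfolding sub_def by (auto simp: eval_gen)
  ultimately show "form_map t B' g = form_map t B (sub u g)" unfolding form_map_def by simp
qed (use u inj in auto)

text \<open>The power map is undone by raising to an inverse of \<open>c\<close> modulo
  \<open>p^N\<close>.\<close>

lemma int_pow_coprime_inj:
  assumes x: "x \<in> carrier G" "y \<in> carrier G" and c: "coprime c (int p)" and eq: "x [^] c = y [^] c"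
  shows "x = y"
proof -
  have "\<not> int p dvd c"
    using c prime_p by (metis coprime_absorb_right coprime_commute not_prime_unit prime_nat_int_transfer)
  then obtain v where v: "int p ^ N dvd c * v - 1" using ex_inverse_mod_prime_power[OF prime_p] by blast
  have cancel: "z = (z [^] c) [^] v" if z: "z \<in> carrier G" for z
  proof -
    have "(z [^] c) [^] v = z [^] ((c * v - 1) + 1)" using z by (simp add: int_pow_pow)
    also have "\<dots> = z" using z int_pow_card[OF z v] by (subst int_pow_mult) auto
    finally show ?thesis by simp
  qed
  show ?thesis using cancel[OF x(1)] cancel[OF x(2)] eq by simp
qed

text \<open>The other coordinates can be read off directly, and they determine the monomial, which
  omits \<open>x_i\<close>. Cancelling it leaves the power \<open>g i [^] a i\<close>, from which
  \<open>g i\<close> is recovered by coprimality.\<close>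

lemma row_substitution:
  fixes a :: "nat \<Rightarrow> int"
  assumes i: "i \<in> I" and c: "coprime (a i) (int p)" and a0: "\<forall>j. j \<notin> I \<longrightarrow> a j = 0"
  obtains u where "\<forall>j\<in>I. u j \<in> words k" "inj_on (sub u) (assignments G k)"
    "\<forall>j. j \<noteq> i \<longrightarrow> u j = gen j"
    "\<forall>m x. exps (u m) x = (if m = i then a x else if x = m then 1 else 0)"
proof -
  define u where "u j = (if j = i then gen_pow i (a i) @ monomial_word (a(i := 0)) k else gen j)" for j
  have w: "\<forall>j\<in>I. u j \<in> words k"
    using i unfolding u_def by (auto simp: words_append gen_pow_in_words monomial_word_in_words gen_in_words)
  have e: "exps (u m) x = (if m = i then a x else if x = m then 1 else 0)" for m x
    using a0 i unfolding u_def
    by (auto simp: exps_append exps_gen_pow exps_monomial_word exps_gen)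
  have "inj_on (sub u) (assignments G k)"
  proof (rule inj_onI)
    fix g g' assume g: "g \<in> assignments G k" and g': "g' \<in> assignments G k" and eq: "sub u g = sub u g'"
    have rest: "g j = g' j" if "j \<in> I" "j \<noteq> i" for j
    proof -
      have "sub u g j = sub u g' j" using eq by simp
      then show ?thesis
        using that assignmentsD[OF g] assignmentsD[OF g'] unfolding sub_def u_def by (simp add: eval_gen)
    qed
    let ?M = "monomial_word (a(i := 0)) k"
    have mw: "?M \<in> words k" "gen_pow i (a i) \<in> words k"
      using i by (auto simp: monomial_word_in_words gen_pow_in_words)
    have M: "eval_word G g ?M = eval_word G g' ?M"
    proof (rule eval_word_cong)
      fix j b assume "(j, b) \<in> set ?M"
      then have "(a(i := 0)) j \<noteq> 0 \<and> j \<in> {1..k}" by (rule letters_monomial_word)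
      then show "g j = g' j" using rest by (auto split: if_splits)
    qed
    have gi: "g i \<in> carrier G" "g' i \<in> carrier G" using assignmentsD[OF g i] assignmentsD[OF g' i] .
    have "sub u g i = sub u g' i" using eq by simp
    then have "g i [^] a i \<otimes> eval_word G g ?M = g' i [^] a i \<otimes> eval_word G g' ?M"
      using i gi unfolding sub_def u_def
      by (simp add: eval_word_append[OF g mw(2,1)] eval_word_append[OF g' mw(2,1)] eval_gen_pow)
    then have "g i [^] a i = g' i [^] a i"
      using gi eval_word_closed[OF g' mw(1)] unfolding M by simp
    then have "g i = g' i" using int_pow_coprime_inj[OF gi c] by simp
    then show "g = g'" using rest by (intro assignments_eqI[OF g g']) auto
  qed
  moreover have "\<forall>j. j \<noteq> i \<longrightarrow> u j = gen j" unfolding u_def by simp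
  ultimately show ?thesis using that[of u] w e by blast
qed

lemma inj_on_sub_permutation:
  assumes "\<rho> permutes I"
  shows "inj_on (sub (\<lambda>j. gen (\<rho> j))) (assignments G k)"
proof (rule inj_onI)
  have val: "sub (\<lambda>j. gen (\<rho> j)) g j = g (\<rho> j)" if "g \<in> assignments G k" "j \<in> I" for g j
    using that assignmentsD[OF that(1)] permutes_in_image[OF assms, of j] unfolding sub_def
    by (simp add: eval_gen)
  fix g g' assume g: "g \<in> assignments G k" and g': "g' \<in> assignments G k"
    and eq: "sub (\<lambda>j. gen (\<rho> j)) g = sub (\<lambda>j. gen (\<rho> j)) g'"
  show "g = g'"
  proof (rule assignments_eqI[OF g g'])
    fix i assume "i \<in> I"
    then obtain j where j: "j \<in> I" "i = \<rho> j" using permutes_image[OF assms] by blast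
    then show "g i = g' i" using val[OF g j(1)] val[OF g' j(1)] eq by simp
  qed
qed

lemma gen_permutation_in_words: "\<rho> permutes I \<Longrightarrow> \<forall>j\<in>I. gen (\<rho> j) \<in> words k"
  using permutes_in_image[of \<rho> I] by (simp add: gen_in_words)

text \<open>There are two reasons why \<open>B\<close> may change modulo \<open>p^r\<close>: if
  \<open>t = p^r\<close>, a central twist of \<open>x_1\<close> contributes t-th powers of
  commutators; if \<open>N \<le> r\<close>, the change is invisible because all orders divide
  \<open>p^N\<close>. The condition \<open>t = 0 \<or> 1 \<le> h\<close> ensures that
  \<open>x_1\<close> is left alone whenever a power of it is present.\<close>

lemma auto_equiv_form_step:
  assumes step: "form_step p r k h k B B'" and alt: "alternating_on k B"
    and t: "t = 0 \<or> 1 \<le> h" and r: "t = int p ^ r \<or> N \<le> r"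
  shows "auto_equiv (form_map t B) (form_map t B')"
proof -
  have alt': "alternating_on k B'" using alternating_on_form_step[OF step order_refl alt] .
  from step show ?thesis
  proof cases
    case (row i a)
    have i: "i \<in> I" using row(2) by auto
    have "a j = 0" if "j \<notin> I" for j using row(4)[of j] row(5) that by (cases "j = 0") auto
    then have a0: "\<forall>j. j \<notin> I \<longrightarrow> a j = 0" by blast
    obtain u where u: "\<forall>j\<in>I. u j \<in> words k" "inj_on (sub u) (assignments G k)"
      "\<forall>j. j \<noteq> i \<longrightarrow> u j = gen j"
      "\<forall>m x. exps (u m) x = (if m = i then a x else if x = m then 1 else 0)"
      using row_substitution[OF i row(3) a0] .
    have delta: "(\<Sum>n\<in>I. f n * exps (u n) y) = (if y = i then 0 else f y) + a y * f i" if "y \<in> I" for f y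
      using sum_replaced_row[OF _ i that, of f "a y"] u(4) by simp
    show ?thesis
    proof (rule auto_equiv_form_map[OF _ u(2) _ alt alt'])
      show "\<forall>j\<in>I. u j \<in> words k" by (rule u(1))
      show "t = 0 \<or> u 1 = gen 1" using t u(3) row(2) by auto
      fix x y assume xy: "x \<in> I" "y \<in> I"
      have "(\<Sum>m\<in>I. \<Sum>n\<in>I. exps (u m) x * B m n * exps (u n) y)
        = (\<Sum>m\<in>I. (\<Sum>n\<in>I. B m n * exps (u n) y) * exps (u m) x)"
        by (simp add: sum_distrib_right sum_distrib_left ac_simps)
      also have "\<dots> = B' x y"
        unfolding delta[OF xy(1)] delta[OF xy(2)] row(1) row_change_def
        using alternating_onD(2)[OF alt, of i] by (auto simp: algebra_simps)
      finally show "(\<Sum>m\<in>I. \<Sum>n\<in>I. exps (u m) x * B m n * exps (u n) y) = B' x y" .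
    qed
  next
    case (perm \<pi>)
    have \<pi>I: "\<pi> permutes I" by (rule permutes_subset[OF perm(2)]) auto
    \<comment> \<open>Substituting \<open>x_(\<rho> j)\<close> for \<open>x_j\<close> permutes the
      entries of the form by the inverse of \<open>\<rho>\<close>, so \<open>\<rho>\<close> must be
      the inverse of \<open>\<pi>\<close>.\<close>
    let ?\<rho> = "inv_into UNIV \<pi>"
    have \<rho>I: "?\<rho> permutes I" using permutes_inv[OF \<pi>I] .
    have \<rho>: "x = ?\<rho> m \<longleftrightarrow> m = \<pi> x" for x m
      using permutes_inverses[OF \<pi>I] by metis
    define u where "u j = gen (?\<rho> j)" for j
    show ?thesis
    proof (rule auto_equiv_form_map[OF _ _ _ alt alt', of u])
      show "\<forall>j\<in>I. u j \<in> words k"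
        unfolding u_def by (rule gen_permutation_in_words[OF \<rho>I])
      show "inj_on (sub u) (assignments G k)"
        unfolding u_def by (rule inj_on_sub_permutation[OF \<rho>I])
      have "?\<rho> 1 = 1" if "1 \<le> h"
        using that permutes_not_in[OF perm(2), of 1] \<rho>[of 1 1] by simp
      then show "t = 0 \<or> u 1 = gen 1" using t unfolding u_def by auto
      fix x y assume xy: "x \<in> I" "y \<in> I"
      then have \<pi>xy: "\<pi> x \<in> I" "\<pi> y \<in> I" using permutes_in_image[OF \<pi>I] by auto
      have "(\<Sum>m\<in>I. \<Sum>n\<in>I. exps (u m) x * B m n * exps (u n) y)
        = (\<Sum>m\<in>I. \<Sum>n\<in>I. if n = \<pi> y then (if m = \<pi> x then B m n else 0) else 0)"
        by (intro sum.cong) (auto simp: u_def exps_gen \<rho>)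
      also have "\<dots> = B (\<pi> x) (\<pi> y)" using \<pi>xy by (simp add: sum.delta)
      finally show "(\<Sum>m\<in>I. \<Sum>n\<in>I. exps (u m) x * B m n * exps (u n) y) = B' x y"
        unfolding perm(1) .
    qed
  next
    case modulo
    show ?thesis
    proof (cases "N \<le> r")
      case True
      have "int p ^ N dvd B i j - B' i j" for i j
        using modulo(1)[of i j] True by (meson dvd_trans le_imp_power_dvd)
      then have "Q (upper B) g = Q (upper B') g" if "g \<in> assignments G k" for g
        by (intro Q_eqI[OF that]) (simp add: upper_skew[OF alt] upper_skew[OF alt'])
      then show ?thesis by (intro auto_equiv_refl) (simp add: form_map_def)
    next
      case False
      then have t: "t = int (p ^ r)" using r by simp
      \<comment> \<open>Twisting \<open>x_1\<close> by \<open>Q C\<close> multiplies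
        \<open>g 1 [^] t\<close> by the t-th power of \<open>Q C\<close>, so \<open>t * C\<close>
        has to be the difference of the two exponent matrices.\<close>
      define C where "C i j = (upper B' i j - upper B i j) div int p ^ r" for i j
      have C: "upper B i j + t * C i j = upper B' i j" for i j
      proof -
        have "int p ^ r dvd upper B' i j - upper B i j"
          using modulo(1)[of i j] unfolding upper_def by (simp add: dvd_diff_commute)
        then show ?thesis unfolding C_def t by simp
      qed
      obtain u where u: "\<forall>i\<in>I. u i \<in> words k" "inj_on (sub u) (assignments G k)"
        "\<forall>g\<in>assignments G k. \<forall>i\<in>I. sub u g i = g i \<otimes> (if i = 1 then Q C g else \<one>)"
        by (rule ex_central_twist)
      have "form_map t B' g = form_map t B (sub u g)" if g: "g \<in> assignments G k" for g
      proof -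
        have g1: "g 1 \<in> carrier G" using assignmentsD[OF g] k_pos by simp
        note q = cenD[OF Q_closed[OF g]]
        have Qu: "Q (upper B) (sub u g) = Q (upper B) g"
          by (rule Q_central[OF g, of "\<lambda>i. if i = 1 then Q C g else \<one>"])
            (use u(3) g subgroup.one_closed[OF subgroup_cen] in auto)
        have "sub u g 1 [^] t = (g 1 \<otimes> Q C g) [^] t" using u(3) g k_pos by simp
        also have "\<dots> = g 1 [^] t \<otimes> Q C g [^] t"
          using int_pow_mult_distrib[OF q(2)[OF g1, symmetric] g1 q(1)] .
        also have "Q C g [^] t = Q (\<lambda>i j. t * C i j) g" by (rule Q_pow[OF g])
        finally have "form_map t B (sub u g) = g 1 [^] t \<otimes> (Q (upper B) g \<otimes> Q (\<lambda>i j. t * C i j) g)"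
          unfolding form_map_def Qu
          using g1 q(1) q(2)[of "Q (\<lambda>i j. t * C i j) g" "upper B"] by (simp add: m_assoc)
        also have "\<dots> = form_map t B' g"
          unfolding form_map_def Q_add[OF g, symmetric] C ..
        finally show ?thesis by simp
      qed
      then show ?thesis unfolding auto_equiv_def using u(1,2) by blast
    qed
  qed
qed

lemma auto_equiv_form_steps:
  assumes "(form_step p r k h k)\<^sup>*\<^sup>* B B'" and alt: "alternating_on k B"
    and t: "t = 0 \<or> 1 \<le> h" and r: "t = int p ^ r \<or> N \<le> r"
  shows "auto_equiv (form_map t B) (form_map t B')"
  using assms(1)
proof (induction rule: rtranclp_induct)
  case base
  show ?case by (rule auto_equiv_refl) simp
next
  case (step C D)
  have "alternating_on k C" using alternating_on_form_steps[OF step.hyps(1) order_refl alt] .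
  then show ?case
    using auto_equiv_trans[OF step.IH auto_equiv_form_step[OF step.hyps(2) _ t r]] by simp
qed

section \<open>Evaluation of \<open>v_p\<close>\<close>

lemma eval_commutator_powers:
  assumes g: "g \<in> assignments G k" and "distinct es" "set es \<subseteq> {1..<k}"
  shows "eval_word G g (concat (map (\<lambda>i. word_pow (comm_word (gen i) (gen (Suc i))) (p ^ s i)) es))
      = Q (\<lambda>i j. if j = Suc i \<and> i \<in> set es then int p ^ s i else 0) g"
    and "concat (map (\<lambda>i. word_pow (comm_word (gen i) (gen (Suc i))) (p ^ s i)) es) \<in> words k"
proof -
  let ?f = "\<lambda>i. word_pow (comm_word (gen i) (gen (Suc i))) (p ^ s i)"
  have cw: "comm_word (gen i) (gen (Suc i)) \<in> words k" "gen i \<in> words k" "gen (Suc i) \<in> words k"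
    if "i \<in> {1..<k}" for i
    using that by (auto simp: comm_word_in_words gen_in_words)
  have "eval_word G g (concat (map ?f es)) = Q (\<lambda>i j. if j = Suc i \<and> i \<in> set es then int p ^ s i else 0) g
    \<and> concat (map ?f es) \<in> words k"
    using assms(2,3)
  proof (induction es)
    case Nil
    then show ?case using g by (simp add: words_Nil)
  next
    case (Cons e es)
    then have e: "e \<in> {1..<k}" "e \<notin> set es" by auto
    have IH: "eval_word G g (concat (map ?f es)) = Q (\<lambda>i j. if j = Suc i \<and> i \<in> set es then int p ^ s i else 0) g"
      "concat (map ?f es) \<in> words k" using Cons by auto
    let ?E = "\<lambda>i j. exps (gen e) i * exps (gen (Suc e)) j"
    have few: "?f e \<in> words k" using eval_word_pow(2)[OF g cw(1)[OF e(1)]] .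
    have "eval_word G g (?f e) = Q ?E g [^] (p ^ s e)"
      using eval_word_pow(1)[OF g cw(1)[OF e(1)]] eval_comm_word[OF g cw(2,3)[OF e(1)]]
        comm_eval_word[OF g cw(2,3)[OF e(1)]] by simp
    also have "\<dots> = Q ?E g [^] int (p ^ s e)" by (simp only: int_pow_int)
    also have "\<dots> = Q (\<lambda>i j. int (p ^ s e) * ?E i j) g" by (rule Q_pow[OF g])
    finally have "eval_word G g (concat (map ?f (e # es)))
      = Q (\<lambda>i j. int (p ^ s e) * ?E i j + (if j = Suc i \<and> i \<in> set es then int p ^ s i else 0)) g"
      using eval_word_append[OF g few IH(2)] IH(1) Q_add[OF g, of "\<lambda>i j. int (p ^ s e) * ?E i j"] by simp
    also have "(\<lambda>i j. int (p ^ s e) * ?E i j + (if j = Suc i \<and> i \<in> set es then int p ^ s i else 0))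
      = (\<lambda>i j. if j = Suc i \<and> i \<in> set (e # es) then int p ^ s i else 0)"
      using e(2) by (intro ext) (auto simp: exps_gen)
    finally show ?case using few IH(2) by (simp add: words_append)
  qed
  then show "eval_word G g (concat (map ?f es))
      = Q (\<lambda>i j. if j = Suc i \<and> i \<in> set es then int p ^ s i else 0) g"
    and "concat (map ?f es) \<in> words k" by auto
qed

lemma eval_v_word:
  assumes g: "g \<in> assignments G k" and "1 \<le> l" "l \<le> n" "n \<le> k"
  shows "eval_word G g (v_word p t l n s) = form_map (int t) (edge_form p (v_edges l n) s) g"
proof -
  let ?f = "\<lambda>i. word_pow (comm_word (gen i) (gen (Suc i))) (p ^ s i)"
  let ?es = "[1..<l] @ filter (\<lambda>j. even (j - l)) [l..<n]"
  have es: "distinct ?es" "set ?es = v_edges l n" "set ?es \<subseteq> {1..<k}"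
    using assms(2-4) unfolding v_edges_def by auto
  have g1: "gen 1 \<in> words k" "g 1 \<in> carrier G"
    using k_pos assignmentsD[OF g] by (auto simp: gen_in_words)
  have "v_word p t l n s = word_pow (gen 1) t @ concat (map ?f ?es)"
    unfolding v_word_def by simp
  then have "eval_word G g (v_word p t l n s)
    = g 1 [^] t \<otimes> Q (\<lambda>i j. if j = Suc i \<and> i \<in> set ?es then int p ^ s i else 0) g"
    using eval_word_append[OF g eval_word_pow(2)[OF g g1(1)] eval_commutator_powers(2)[OF g es(1,3)]]
      eval_word_pow(1)[OF g g1(1)] eval_commutator_powers(1)[OF g es(1,3)] g1(2)
    by (simp add: eval_gen)
  moreover have "(\<lambda>i j. if j = Suc i \<and> i \<in> v_edges l n then int p ^ s i else 0)
      = upper (edge_form p (v_edges l n) s)"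
    unfolding upper_def edge_form_def by (intro ext) auto
  ultimately show ?thesis unfolding form_map_def es(2) by (simp add: int_pow_int)
qed

section \<open>Normalising the exponent sums of a word\<close>

lemma auto_equiv_subst_word:
  assumes "\<forall>i\<in>I. u i \<in> words k" "inj_on (sub u) (assignments G k)" "w \<in> words k"
  shows "auto_equiv (\<lambda>g. eval_word G g w) (\<lambda>g. eval_word G g (subst_word u w))"
  unfolding auto_equiv_def using assms eval_word_sub[OF _ assms(1,3)] by auto

lemma eval_word_form_map:
  assumes w: "w \<in> words k"
    and t: "\<forall>j\<in>I. int p ^ N dvd exps w j - (if j = 1 then t else 0)"
  obtains B where "alternating_on k B" "\<forall>g\<in>assignments G k. eval_word G g w = form_map t B g"
proof -
  obtain U where U: "\<And>g. g \<in> assignments G k \<Longrightarrow> eval_word G g w = g 1 [^] t \<otimes> Q U g"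
    using eval_word_normal[OF w, of t] t by blast
  define B where "B i j = (if i \<in> I \<and> j \<in> I then U i j - U j i else 0)" for i j
  have alt: "alternating_on k B" unfolding alternating_on_def B_def by auto
  have "Q U g = Q (upper B) g" if "g \<in> assignments G k" for g
    by (rule Q_eqI[OF that], simp only: upper_skew[OF alt]) (simp add: B_def)
  then show ?thesis using that[OF alt] U unfolding form_map_def by simp
qed

text \<open>Dividing the exponent vector by the largest common power of \<open>p\<close> leaves a
  coordinate \<open>i\<close> that is a unit. One replacement of \<open>x_i\<close> clears all other
  coordinates modulo \<open>p^N\<close>, and a transposition moves \<open>i\<close> to 1.\<close>

lemma auto_equiv_prime_power_form_map:
  assumes w: "w \<in> words k"
  obtains r B where "r \<le> N" "alternating_on k B"
    "auto_equiv (\<lambda>g. eval_word G g w) (form_map (int p ^ r) B)"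
proof (cases "\<forall>j\<in>I. int p ^ N dvd exps w j")
  \<comment> \<open>If all exponents vanish modulo \<open>p^N\<close>, the trivial power
    \<open>x_1^(p^N)\<close> is used as the leading factor.\<close>
  case True
  then have "\<forall>j\<in>I. int p ^ N dvd exps w j - (if j = 1 then int p ^ N else 0)" by auto
  then obtain B where "alternating_on k B"
    "\<forall>g\<in>assignments G k. eval_word G g w = form_map (int p ^ N) B g"
    by (rule eval_word_form_map[OF w])
  then show ?thesis by (intro that[OF order_refl] auto_equiv_refl)
next
  case False
  define r where "r = (GREATEST r. \<forall>j\<in>I. int p ^ r dvd exps w j)"
  have bound: "s \<le> N" if "\<forall>j\<in>I. int p ^ s dvd exps w j" for s
    using that False by (meson dvd_trans le_imp_power_dvd nat_le_linear)
  have r: "\<forall>j\<in>I. int p ^ r dvd exps w j"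
    unfolding r_def by (rule GreatestI_nat[of _ 0 N]) (use bound in auto)
  have "\<not> (\<forall>j\<in>I. int p ^ Suc r dvd exps w j)"
  proof
    assume "\<forall>j\<in>I. int p ^ Suc r dvd exps w j"
    then have "Suc r \<le> r"
      unfolding r_def by (intro Greatest_le_nat[of _ _ N]) (use bound in auto)
    then show False by simp
  qed
  then obtain i where i: "i \<in> I" "\<not> int p ^ Suc r dvd exps w i" by blast
  define d where "d j = exps w j div int p ^ r" for j
  have d: "exps w j = int p ^ r * d j" if "j \<in> I" for j using r that unfolding d_def by simp
  have "\<not> int p dvd d i"
  proof
    assume "int p dvd d i"
    then have "int p ^ Suc r dvd exps w i"
      unfolding d[OF i(1)] by (metis dvd_refl mult_dvd_mono power_Suc2)
    then show False using i(2) by simp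
  qed
  then obtain v where v: "int p ^ N dvd d i * v - 1" "coprime v (int p)"
    using ex_inverse_mod_prime_power[OF prime_p] by blast
  \<comment> \<open>The new exponent at \<open>i\<close> is \<open>p^r d_i v\<close>, and at any
    other \<open>j\<close> it is \<open>p^r d_j (1 - d_i v)\<close>.\<close>
  define a where "a j = (if j = i then v else if j \<in> I then - v * d j else 0)" for j
  have ai: "coprime (a i) (int p)" "\<forall>j. j \<notin> I \<longrightarrow> a j = 0" using v(2) i(1) unfolding a_def by auto
  obtain u where u: "\<forall>j\<in>I. u j \<in> words k" "inj_on (sub u) (assignments G k)"
    "\<forall>j. j \<noteq> i \<longrightarrow> u j = gen j"
    "\<forall>m x. exps (u m) x = (if m = i then a x else if x = m then 1 else 0)"
    using row_substitution[OF i(1) ai] .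
  define w2 where "w2 = subst_word u w"
  have w2: "w2 \<in> words k" unfolding w2_def using subst_word_in_words[OF u(1) w] .
  have e2: "int p ^ N dvd exps w2 j - (if j = i then int p ^ r else 0)" if j: "j \<in> I" for j
  proof -
    have "exps w2 j = (if j = i then 0 else exps w j) + a j * exps w i"
      unfolding w2_def exps_subst_word[OF w]
      using sum_replaced_row[OF _ i(1) j, of "exps w" "a j"] u(4) by simp
    then have "exps w2 j - (if j = i then int p ^ r else 0)
      = (if j = i then int p ^ r else - (int p ^ r * d j)) * (d i * v - 1)"
      using j unfolding d[OF i(1)] d[OF j] a_def by (auto simp: algebra_simps)
    then show ?thesis using v(1) by simp
  qed
  let ?\<tau> = "transpose 1 i"
  have \<tau>: "?\<tau> permutes I" using i(1) k_pos by (intro permutes_swap_id) auto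
  define w3 where "w3 = subst_word (\<lambda>j. gen (?\<tau> j)) w2"
  have w3: "w3 \<in> words k"
    unfolding w3_def using subst_word_in_words[OF gen_permutation_in_words[OF \<tau>] w2] .
  have "\<forall>j\<in>I. int p ^ N dvd exps w3 j - (if j = 1 then int p ^ r else 0)"
  proof
    fix j assume j: "j \<in> I"
    have \<tau>j: "?\<tau> j \<in> I" using permutes_in_image[OF \<tau>] j by blast
    have "exps w3 j = (\<Sum>m\<in>I. if m = ?\<tau> j then exps w2 m else 0)"
      unfolding w3_def exps_subst_word[OF w2]
      by (rule sum.cong) (auto simp: exps_gen transpose_def split: if_splits)
    also have "\<dots> = exps w2 (?\<tau> j)" using \<tau>j by simp
    finally show "int p ^ N dvd exps w3 j - (if j = 1 then int p ^ r else 0)"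
      using e2[OF \<tau>j] by (auto simp: transpose_def split: if_splits)
  qed
  then obtain B where B: "alternating_on k B"
    "\<forall>g\<in>assignments G k. eval_word G g w3 = form_map (int p ^ r) B g"
    by (rule eval_word_form_map[OF w3])
  have "auto_equiv (\<lambda>g. eval_word G g w) (\<lambda>g. eval_word G g w3)"
    using auto_equiv_trans[OF auto_equiv_subst_word[OF u(1,2) w]
        auto_equiv_subst_word[OF gen_permutation_in_words[OF \<tau>] inj_on_sub_permutation[OF \<tau>]
          w2[unfolded w2_def]]]
    unfolding w3_def w2_def .
  then have "auto_equiv (\<lambda>g. eval_word G g w) (form_map (int p ^ r) B)"
    by (rule auto_equiv_trans[OF _ auto_equiv_refl[OF B(2)]])
  then show ?thesis by (rule that[OF bound[OF r] B(1)])
qed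

text \<open>For \<open>t = 1\<close> the map is the first coordinate of a central twist, so it is
  equivalent to projection onto that coordinate. The fibres of the projection correspond by
  overwriting coordinate 1.\<close>

lemma card_eq_of_form_map_one:
  assumes "auto_equiv f (form_map 1 B)" and "x \<in> carrier G" "y \<in> carrier G"
  shows "card {g \<in> assignments G k. f g = x} = card {g \<in> assignments G k. f g = y}"
proof -
  have one: "1 \<in> I" using k_pos by simp
  obtain u where u: "\<forall>i\<in>I. u i \<in> words k" "inj_on (sub u) (assignments G k)"
    "\<forall>g\<in>assignments G k. \<forall>i\<in>I. sub u g i = g i \<otimes> (if i = 1 then Q (upper B) g else \<one>)"
    by (rule ex_central_twist)
  have "auto_equiv (\<lambda>g. g 1) (form_map 1 B)"
    unfolding auto_equiv_def
  proof (intro exI[of _ u] conjI ballI)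
    show "form_map 1 B g = sub u g 1" if g: "g \<in> assignments G k" for g
      using u(3) g one assignmentsD[OF g one] unfolding form_map_def by simp
  qed (use u in auto)
  then have eq: "card {g \<in> assignments G k. f g = z} = card {g \<in> assignments G k. g 1 = z}" for z
    using auto_equiv_card[OF assms(1), of z] auto_equiv_card[of "\<lambda>g. g 1" "form_map 1 B" z] by simp
  have upd: "g(1 := z) \<in> assignments G k" if "g \<in> assignments G k" "z \<in> carrier G" for g z
    using that one unfolding assignments_def by (auto simp: PiE_iff extensional_def)
  have "bij_betw (\<lambda>g. g(1 := y)) {g \<in> assignments G k. g 1 = x} {g \<in> assignments G k. g 1 = y}"
    by (rule bij_betw_byWitness[where f' = "\<lambda>g. g(1 := x)"]) (use upd assms(2,3) in auto)
  then show ?thesis unfolding eq by (rule bij_betw_same_card)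
qed

end

text \<open>A commutator lies in the second term of the lower central series, so its commutator with
  any element lies in the third term, which is trivial.\<close>

lemma p_group_class_two_intro:
  assumes "Factorial_Ring.prime p" "finite_p_group p G" "nilpotency_class_two G" "1 \<le> k"
  obtains N where "p_group_class_two G p N k"
proof -
  obtain N where G: "group G" "finite (carrier G)" "card (carrier G) = p ^ N"
    using assms(2) unfolding finite_p_group_def by blast
  interpret group G by (rule G(1))
  have L3: "lower_central G (Suc (Suc (Suc 0))) = {\<one>\<^bsub>G\<^esub>}"
    using assms(3) unfolding nilpotency_class_two_def by (simp add: numeral_eq_Suc)
  have "x \<otimes>\<^bsub>G\<^esub> y \<otimes>\<^bsub>G\<^esub> inv\<^bsub>G\<^esub> x \<otimes>\<^bsub>G\<^esub> inv\<^bsub>G\<^esub> y \<otimes>\<^bsub>G\<^esub> z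
      = z \<otimes>\<^bsub>G\<^esub> (x \<otimes>\<^bsub>G\<^esub> y \<otimes>\<^bsub>G\<^esub> inv\<^bsub>G\<^esub> x \<otimes>\<^bsub>G\<^esub> inv\<^bsub>G\<^esub> y)"
    if x: "x \<in> carrier G" and y: "y \<in> carrier G" and z: "z \<in> carrier G" for x y z
  proof -
    define c where "c = x \<otimes>\<^bsub>G\<^esub> y \<otimes>\<^bsub>G\<^esub> inv\<^bsub>G\<^esub> x \<otimes>\<^bsub>G\<^esub> inv\<^bsub>G\<^esub> y"
    have cc: "c \<in> carrier G" unfolding c_def using x y by simp
    have "c \<in> lower_central G (Suc (Suc 0))"
      unfolding c_def lower_central.simps by (rule generate.incl) (use x y in auto)
    then have "c \<otimes>\<^bsub>G\<^esub> z \<otimes>\<^bsub>G\<^esub> inv\<^bsub>G\<^esub> c \<otimes>\<^bsub>G\<^esub> inv\<^bsub>G\<^esub> z \<in> lower_central G (Suc (Suc (Suc 0)))"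
      unfolding lower_central.simps(3)[of G "Suc 0"] using z by (intro generate.incl) blast
    then have "c \<otimes>\<^bsub>G\<^esub> z \<otimes>\<^bsub>G\<^esub> (inv\<^bsub>G\<^esub> c \<otimes>\<^bsub>G\<^esub> inv\<^bsub>G\<^esub> z) = \<one>\<^bsub>G\<^esub>"
      using cc z unfolding L3 by (simp add: m_assoc)
    then have "c \<otimes>\<^bsub>G\<^esub> z \<otimes>\<^bsub>G\<^esub> inv\<^bsub>G\<^esub> (z \<otimes>\<^bsub>G\<^esub> c) = \<one>\<^bsub>G\<^esub>"
      using cc z by (simp add: inv_mult_group)
    then have "c \<otimes>\<^bsub>G\<^esub> z = z \<otimes>\<^bsub>G\<^esub> c"
      using cc z by (metis inv_closed inv_equality inv_inv m_closed)
    then show ?thesis unfolding c_def .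
  qed
  then have "p_group_class_two G p N k"
    by unfold_locales (use assms G in auto)
  then show ?thesis by (rule that)
qed

theorem theorem3p4:
  fixes p k :: nat and G :: "('a, 'b) monoid_scheme" and w :: "letter list"
  assumes "Factorial_Ring.prime p"
    and "finite_p_group p G"
    and "nilpotency_class_two G"
    and "1 \<le> k"
    and "w \<in> words k"
  shows "(\<not> in_commutator_subgroup k w \<longrightarrow>
            (\<exists>c. \<forall>h \<in> carrier G. P_prob k w G h = c)
          \<or> (\<exists>r l n s. r > 0 \<and> 1 \<le> l \<and> l \<le> n \<and> n \<le> k
                \<and> (\<forall>i j. 1 \<le> i \<and> i < j \<and> j \<le> l - 1 \<longrightarrow> s i < s j)
                \<and> (\<forall>i. 1 \<le> i \<and> i \<le> l - 1 \<longrightarrow> s i < r)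
                \<and> (\<forall>j. l \<le> j \<and> j \<le> n - 1 \<longrightarrow> s j < r)
                \<and> automorphic G k w (v_word p (p ^ r) l n s)))
       \<and> (in_commutator_subgroup k w \<longrightarrow>
            (\<exists>n s. 1 \<le> n \<and> n \<le> k \<and> automorphic G k w (v_word p 0 1 n s)))"
proof -
  note w = assms(5)
  obtain N where "p_group_class_two G p N k"
    using p_group_class_two_intro[OF assms(1-4)] .
  then interpret p_group_class_two G p N k .
  have "(\<exists>c. \<forall>h \<in> carrier G. P_prob k w G h = c)
          \<or> (\<exists>r l n s. r > 0 \<and> 1 \<le> l \<and> l \<le> n \<and> n \<le> k
                \<and> (\<forall>i j. 1 \<le> i \<and> i < j \<and> j \<le> l - 1 \<longrightarrow> s i < s j)
                \<and> (\<forall>i. 1 \<le> i \<and> i \<le> l - 1 \<longrightarrow> s i < r)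
                \<and> (\<forall>j. l \<le> j \<and> j \<le> n - 1 \<longrightarrow> s j < r)
                \<and> automorphic G k w (v_word p (p ^ r) l n s))"
  proof -
    obtain r B where B: "alternating_on k B"
      and eq: "auto_equiv (\<lambda>g. eval_word G g w) (form_map (int p ^ r) B)"
      using auto_equiv_prime_power_form_map[OF w] by blast
    show ?thesis
    proof (cases "r = 0")
      case True
      then have eq1: "auto_equiv (\<lambda>g. eval_word G g w) (form_map 1 B)" using eq by simp
      have "P_prob k w G h = P_prob k w G \<one>\<^bsub>G\<^esub>" if "h \<in> carrier G" for h
        unfolding P_prob_def card_eq_of_form_map_one[OF eq1 that one_closed] ..
      then show ?thesis by blast
    next
      case False
      obtain l n s where ln: "1 \<le> l" "l \<le> n" "n \<le> k"
        and incr: "\<forall>i j. 1 \<le> i \<and> i < j \<and> j < l \<longrightarrow> s i < s j"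
        and bnd: "\<forall>i\<in>v_edges l n. s i < r"
        and steps: "(form_step p r k 1 k)\<^sup>*\<^sup>* B (edge_form p (v_edges l n) s)"
        using form_steps_to_v_edges_head[OF assms(1,4) B, of r] .
      \<comment> \<open>The bound \<open>s j < r\<close> is claimed for every \<open>j\<close> up to
        \<open>n - 1\<close>, including those without a commutator factor. There the exponent is
        free, and 0 satisfies the bound as \<open>r > 0\<close>.\<close>
      define s' where "s' i = (if i \<in> v_edges l n then s i else 0)" for i
      have s': "edge_form p (v_edges l n) s = edge_form p (v_edges l n) s'"
        by (rule edge_form_cong) (simp add: s'_def)
      have "auto_equiv (form_map (int p ^ r) B) (form_map (int p ^ r) (edge_form p (v_edges l n) s'))"
        using auto_equiv_form_steps[OF steps B] unfolding s' by simp
      then have "auto_equiv (\<lambda>g. eval_word G g w) (form_map (int (p ^ r)) (edge_form p (v_edges l n) s'))"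
        using auto_equiv_trans[OF eq] by simp
      then have "auto_equiv (\<lambda>g. eval_word G g w) (\<lambda>g. eval_word G g (v_word p (p ^ r) l n s'))"
        by (rule auto_equiv_trans) (intro auto_equiv_refl ballI eval_v_word[OF _ ln, symmetric])
      then have "automorphic G k w (v_word p (p ^ r) l n s')"
        by (rule auto_equiv_automorphic[OF _ w])
      moreover have "s' i < r" for i using False bnd unfolding s'_def by simp
      moreover have "s' i < s' j" if "1 \<le> i \<and> i < j \<and> j \<le> l - 1" for i j
        using incr that unfolding s'_def v_edges_def by auto
      ultimately show ?thesis using False ln by blast
    qed
  qed
  moreover have "\<exists>n s. 1 \<le> n \<and> n \<le> k \<and> automorphic G k w (v_word p 0 1 n s)"
    if "in_commutator_subgroup k w"
  proof -
    have "\<forall>j\<in>I. int p ^ N dvd exps w j - (if j = 1 then 0 else 0)"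
      using exps_in_commutator_subgroup[OF that] by simp
    then obtain B where B: "alternating_on k B"
      "\<forall>g\<in>assignments G k. eval_word G g w = form_map 0 B g"
      by (rule eval_word_form_map[OF w])
    \<comment> \<open>With no power of \<open>x_1\<close> to protect, the head is 0. The modulus is
      \<open>p^N\<close>, at which congruent forms give the same map without any twist.\<close>
    obtain n s where n: "1 \<le> n" "n \<le> k"
      and steps: "(form_step p N k 0 k)\<^sup>*\<^sup>* B (edge_form p (v_edges 1 n) s)"
      using form_steps_to_v_edges_free[OF assms(1,4) B(1)] .
    have "auto_equiv (form_map 0 B) (form_map 0 (edge_form p (v_edges 1 n) s))"
      by (rule auto_equiv_form_steps[OF steps B(1)]) auto
    then have "auto_equiv (\<lambda>g. eval_word G g w) (form_map (int 0) (edge_form p (v_edges 1 n) s))"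
      using auto_equiv_trans[OF auto_equiv_refl[OF B(2)]] by simp
    then have "auto_equiv (\<lambda>g. eval_word G g w) (\<lambda>g. eval_word G g (v_word p 0 1 n s))"
      by (rule auto_equiv_trans) (intro auto_equiv_refl ballI eval_v_word[OF _ order_refl n, symmetric])
    then have "automorphic G k w (v_word p 0 1 n s)"
      by (rule auto_equiv_automorphic[OF _ w])
    then show ?thesis using n by blast
  qed
  ultimately show ?thesis by blast
qed

end
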